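(* Let $M$ be an oriented space-like surface in the Minkowski space $\mathbb E^4_1$ with light-like mean curvature vector. Then $M$ has (global) 1-type Gauss map of the first kind if and only if the Gauss map $\nu$ of $M$ is harmonic.
   Context: $\mathbb E^4_1$ is $\mathbb R^4$ with the metric $-dx_1^2+dx_2^2+dx_3^2+dx_4^2$. A vector $v$ is light-like if $v\ne0$ and $\langle v,v\rangle=0$. A surface $M$ is space-like if every nonzero tangent vector $v$ satisfies $\langle v,v\rangle>0$. The second fundamental form $h$ is defined by $\widetilde\nabla_XY=\nabla_XY+h(X,Y)$, and the mean curvature vector is $H=\frac12(h(e_1,e_1)+h(e_2,e_2))$ for an orthonormal tangent frame; $H$ is light-like if it is light-like at every point of $M$. The Gauss map is $\nu=e_3\wedge e_4:M\to\bigwedge^2\mathbb E^4_1$, where $\{e_1,e_2,e_3,e_4\}$ is an oriented local orthonormal frame with $e_1,e_2$ tangent and $e_3,e_4$ normal to $M$; $\bigwedge^2\mathbb E^4_1$ is identified with a pseudo-Euclidean space via $\langle f_1\wedge f_2,g_1\wedge g_2\rangle=\det(\langle f_i,g_j\rangle)$. The Laplacian $\Delta=\sum_{i=1}^2(\nabla_{e_i}e_i-e_ie_i)$ of $M$ acts componentwise on $\nu$; $\nu$ is harmonic if $\Delta\nu=0$. $M$ has (global) 1-type Gauss map of the first kind if $\Delta\nu=\lambda\nu$ for some constant $\lambda\in\mathbb R$ ($\lambda=0$ allowed). *)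

theory Defs
  imports "HOL-Analysis.Analysis"
begin

subsection \<open>Minkowski space and its bivectors\<close>

definition minkowski :: "real^4 \<Rightarrow> real^4 \<Rightarrow> real" where
  "minkowski v w = - (v$1 * w$1) + v$2 * w$2 + v$3 * w$3 + v$4 * w$4"

definition light_like :: "real^4 \<Rightarrow> bool" where
  "light_like v \<longleftrightarrow> v \<noteq> 0 \<and> minkowski v v = 0"

text \<open>
  Bivectors are represented as alternating matrices: entry \<open>(i, j)\<close> with \<open>i < j\<close> is the
  component with respect to the product of the \<open>i\<close>-th and \<open>j\<close>-th standard basis vectors. These
  six products are, up to sign of their squares, an orthonormal basis for the determinant metric,
  so operating entrywise on matrices is operating componentwise in the pseudo-Euclidean space.
\<close>

definition wedge :: "real^4 \<Rightarrow> real^4 \<Rightarrow> real^4^4" where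
  "wedge v w = (\<chi> i j. v$i * w$j - v$j * w$i)"


subsection \<open>Smooth maps, oriented surfaces and immersions\<close>

text \<open>Intended for open \<open>U\<close> only.\<close>

primrec Ck_on ::
  "nat \<Rightarrow> 'a::euclidean_space set \<Rightarrow> ('a \<Rightarrow> 'b::real_normed_vector) \<Rightarrow> bool" where
  "Ck_on 0 U f \<longleftrightarrow> continuous_on U f"
| "Ck_on (Suc k) U f \<longleftrightarrow>
     f differentiable_on U \<and> (\<forall>v. Ck_on k U (\<lambda>p. frechet_derivative f (at p) v))"

definition smooth_on :: "'a::euclidean_space set \<Rightarrow> ('a \<Rightarrow> 'b::real_normed_vector) \<Rightarrow> bool" where
  "smooth_on U f \<longleftrightarrow> (\<forall>k. Ck_on k U f)"

text \<open>
  An abstract oriented smooth surface: a Hausdorff, second countable space \<open>M\<close> with an atlas \<open>A\<close>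
  of local parametrizations \<open>\<phi> : U \<rightarrow> M\<close>, \<open>U\<close> open in the plane, whose transition maps are smooth
  with positive Jacobian determinant. The atlas need not be maximal.
\<close>

definition oriented_surface :: "'m topology \<Rightarrow> ((real^2) set \<times> (real^2 \<Rightarrow> 'm)) set \<Rightarrow> bool" where
  "oriented_surface M A \<longleftrightarrow>
     Hausdorff_space M \<and> second_countable M \<and>
     (\<forall>(U, \<phi>) \<in> A. open U \<and> openin M (\<phi> ` U) \<and>
        homeomorphic_map (top_of_set U) (subtopology M (\<phi> ` U)) \<phi>) \<and>
     topspace M = (\<Union>(U, \<phi>) \<in> A. \<phi> ` U) \<and>
     (\<forall>(U, \<phi>) \<in> A. \<forall>(V, \<psi>) \<in> A.
        let W = {p \<in> U. \<phi> p \<in> \<psi> ` V}; \<tau> = the_inv_into V \<psi> \<circ> \<phi> in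
        smooth_on W \<tau> \<and> (\<forall>p \<in> W. 0 < det (matrix (frechet_derivative \<tau> (at p)))))"

definition smooth_immersion ::
  "((real^2) set \<times> (real^2 \<Rightarrow> 'm)) set \<Rightarrow> ('m \<Rightarrow> real^4) \<Rightarrow> bool" where
  "smooth_immersion A x \<longleftrightarrow>
     (\<forall>(U, \<phi>) \<in> A. smooth_on U (x \<circ> \<phi>) \<and> (\<forall>p \<in> U. inj (frechet_derivative (x \<circ> \<phi>) (at p))))"

definition space_like_surface ::
  "((real^2) set \<times> (real^2 \<Rightarrow> 'm)) set \<Rightarrow> ('m \<Rightarrow> real^4) \<Rightarrow> bool" where
  "space_like_surface A x \<longleftrightarrow>
     (\<forall>(U, \<phi>) \<in> A. \<forall>p \<in> U. \<forall>v \<in> range (frechet_derivative (x \<circ> \<phi>) (at p)).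
        v \<noteq> 0 \<longrightarrow> 0 < minkowski v v)"


subsection \<open>Local geometry of a parametrized surface\<close>

text \<open>
  Here \<open>r = x \<circ> \<phi>\<close> is the surface in a local parametrization \<open>\<phi>\<close>. Tangent vector fields are given
  by their coordinate fields \<open>X\<close> on the parameter domain; the corresponding vector field along the
  surface is the derivative of \<open>r\<close> along \<open>X\<close>. As the flat connection of the ambient space is
  componentwise differentiation, the ambient covariant derivative of \<open>Y\<close> along \<open>X\<close> is
  \<open>along X (along Y r)\<close>.
\<close>

definition along ::
  "(real^2 \<Rightarrow> real^2) \<Rightarrow> (real^2 \<Rightarrow> 'b::real_normed_vector) \<Rightarrow> real^2 \<Rightarrow> 'b" where
  "along X f p = frechet_derivative f (at p) (X p)"

text \<open>The tangential part of the ambient derivative, in coordinates.\<close>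

definition levi_civita ::
  "(real^2 \<Rightarrow> real^4) \<Rightarrow> (real^2 \<Rightarrow> real^2) \<Rightarrow> (real^2 \<Rightarrow> real^2) \<Rightarrow> real^2 \<Rightarrow> real^2" where
  "levi_civita r X Y p =
     (THE a. \<forall>b. minkowski (along X (along Y r) p - frechet_derivative r (at p) a)
                            (frechet_derivative r (at p) b) = 0)"

definition second_fundamental_form ::
  "(real^2 \<Rightarrow> real^4) \<Rightarrow> (real^2 \<Rightarrow> real^2) \<Rightarrow> (real^2 \<Rightarrow> real^2) \<Rightarrow> real^2 \<Rightarrow> real^4" where
  "second_fundamental_form r X Y p = along X (along Y r) p - along (levi_civita r X Y) r p"

text \<open>\<open>E\<close> is a pair of vector fields, indexed by the two-element type.\<close>

definition mean_curvature_vector ::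
  "(real^2 \<Rightarrow> real^4) \<Rightarrow> (2 \<Rightarrow> real^2 \<Rightarrow> real^2) \<Rightarrow> real^2 \<Rightarrow> real^4" where
  "mean_curvature_vector r E p =
     (1/2) *\<^sub>R (second_fundamental_form r (E 1) (E 1) p + second_fundamental_form r (E 2) (E 2) p)"

definition frame_laplacian ::
  "(real^2 \<Rightarrow> real^4) \<Rightarrow> (2 \<Rightarrow> real^2 \<Rightarrow> real^2) \<Rightarrow> (real^2 \<Rightarrow> 'b::real_normed_vector) \<Rightarrow> real^2 \<Rightarrow> 'b"
where
  "frame_laplacian r E f p =
     (\<Sum>i\<in>UNIV. along (levi_civita r (E i) (E i)) f p - along (E i) (along (E i) f) p)"


subsection \<open>Mean curvature, Laplacian and Gauss map of an immersed surface\<close>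

text \<open>
  A smooth orthonormal tangent frame on an open part \<open>V\<close> of a parameter domain. On a space-like
  surface every parametrization admits one by Gram-Schmidt, and the mean curvature vector and the
  Laplacian do not depend on the choice of frame or parametrization; the conditions below are
  therefore imposed in all of them.
\<close>

definition tangent_frame ::
  "((real^2) set \<times> (real^2 \<Rightarrow> 'm)) set \<Rightarrow> ('m \<Rightarrow> real^4) \<Rightarrow>
   (real^2 \<Rightarrow> 'm) \<Rightarrow> (real^2) set \<Rightarrow> (2 \<Rightarrow> real^2 \<Rightarrow> real^2) \<Rightarrow> bool" where
  "tangent_frame A x \<phi> V E \<longleftrightarrow>
     (\<exists>U. (U, \<phi>) \<in> A \<and> V \<subseteq> U) \<and> open V \<and> (\<forall>i. smooth_on V (E i)) \<and>
     (\<forall>p \<in> V. \<forall>i j. minkowski (along (E i) (x \<circ> \<phi>) p) (along (E j) (x \<circ> \<phi>) p)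
                      = (if i = j then 1 else 0))"

definition light_like_mean_curvature ::
  "((real^2) set \<times> (real^2 \<Rightarrow> 'm)) set \<Rightarrow> ('m \<Rightarrow> real^4) \<Rightarrow> bool" where
  "light_like_mean_curvature A x \<longleftrightarrow>
     (\<forall>\<phi> V E. tangent_frame A x \<phi> V E \<longrightarrow>
        (\<forall>p \<in> V. light_like (mean_curvature_vector (x \<circ> \<phi>) E p)))"

text \<open>\<open>has_laplacian A x f g\<close>: on the whole surface, \<open>\<Delta> f = g\<close>.\<close>

definition has_laplacian ::
  "((real^2) set \<times> (real^2 \<Rightarrow> 'm)) set \<Rightarrow> ('m \<Rightarrow> real^4) \<Rightarrow>
   ('m \<Rightarrow> 'b::real_normed_vector) \<Rightarrow> ('m \<Rightarrow> 'b) \<Rightarrow> bool" where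
  "has_laplacian A x f g \<longleftrightarrow>
     (\<forall>\<phi> V E. tangent_frame A x \<phi> V E \<longrightarrow>
        (\<forall>p \<in> V. frame_laplacian (x \<circ> \<phi>) E (f \<circ> \<phi>) p = g (\<phi> p)))"

text \<open>
  An oriented orthonormal frame at the point \<open>q\<close>: \<open>e 1, e 2\<close> is a positively oriented basis of the
  tangent plane, \<open>e 3, e 4\<close> are normal, and the whole frame is positively oriented in the ambient
  space. Exactly one of the normal vectors is time-like; which one does not affect
  \<open>wedge (e 3) (e 4)\<close>.
\<close>

definition adapted_frame ::
  "((real^2) set \<times> (real^2 \<Rightarrow> 'm)) set \<Rightarrow> ('m \<Rightarrow> real^4) \<Rightarrow> 'm \<Rightarrow> (4 \<Rightarrow> real^4) \<Rightarrow> bool" where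
  "adapted_frame A x q e \<longleftrightarrow>
     (\<exists>(U, \<phi>) \<in> A. \<exists>p \<in> U. \<phi> p = q \<and>
        (let D = frechet_derivative (x \<circ> \<phi>) (at p) in
          (\<exists>a b. e 1 = D a \<and> e 2 = D b \<and> 0 < det (vector [a, b] :: real^2^2)) \<and>
          (\<forall>c. minkowski (e 3) (D c) = 0 \<and> minkowski (e 4) (D c) = 0))) \<and>
     (\<forall>i j. i \<noteq> j \<longrightarrow> minkowski (e i) (e j) = 0) \<and>
     (\<forall>i. \<bar>minkowski (e i) (e i)\<bar> = 1) \<and>
     0 < det (\<chi> i. e i)"

definition gauss_map ::
  "((real^2) set \<times> (real^2 \<Rightarrow> 'm)) set \<Rightarrow> ('m \<Rightarrow> real^4) \<Rightarrow> 'm \<Rightarrow> real^4^4" where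
  "gauss_map A x q = (THE w. \<exists>e. adapted_frame A x q e \<and> w = wedge (e 3) (e 4))"

definition harmonic_gauss_map ::
  "((real^2) set \<times> (real^2 \<Rightarrow> 'm)) set \<Rightarrow> ('m \<Rightarrow> real^4) \<Rightarrow> bool" where
  "harmonic_gauss_map A x \<longleftrightarrow> has_laplacian A x (gauss_map A x) (\<lambda>q. 0)"

definition one_type_gauss_map_first_kind ::
  "((real^2) set \<times> (real^2 \<Rightarrow> 'm)) set \<Rightarrow> ('m \<Rightarrow> real^4) \<Rightarrow> bool" where
  "one_type_gauss_map_first_kind A x \<longleftrightarrow>
     (\<exists>c::real. has_laplacian A x (gauss_map A x) (\<lambda>q. c *\<^sub>R gauss_map A x q))"

end

theory Submission
  imports Defs
begin

text \<open>
  The Gauss map is the Hodge dual of the area bivector \<open>e\<^sub>1 \<and> e\<^sub>2\<close>, which is therefore an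
  eigenfunction with the same eigenvalue \<open>c\<close>. In terms of \<open>\<alpha> = (h\<^sub>1\<^sub>1 - h\<^sub>2\<^sub>2)/2\<close> and \<open>h\<^sub>1\<^sub>2\<close>, the components
  of the eigenvalue equation, with the Codazzi equations and \<open>\<langle>H, H\<rangle> = 0\<close>, say that
  \<open>\<langle>\<alpha>, \<alpha>\<rangle> + \<langle>h\<^sub>1\<^sub>2, h\<^sub>1\<^sub>2\<rangle> = c/2\<close>, that \<open>\<alpha>\<close> and \<open>h\<^sub>1\<^sub>2\<close> are parallel (the normal bundle is flat), and that
  \<open>H\<close> is parallel in the normal bundle. Suppose \<open>c \<noteq> 0\<close>. The vector
  \<open>(C, S) = (\<langle>\<alpha>, \<alpha>\<rangle> - \<langle>h\<^sub>1\<^sub>2, h\<^sub>1\<^sub>2\<rangle>, 2 \<langle>\<alpha>, h\<^sub>1\<^sub>2\<rangle>)\<close> has constant length \<open>\<bar>c\<bar>/2\<close>, and the Codazzi equations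
  show that it rotates at the rate \<open>-4 \<omega>\<close>, where \<open>\<omega>\<close> is the connection form of the tangent frame.
  So \<open>\<omega>\<close> is closed and the surface is flat, whereas the Gauss equation gives the
  curvature \<open>-c/2\<close>.
\<close>

subsection \<open>Smooth maps\<close>

text \<open>\<open>frechet_derivative f (at p)\<close> depends only on the values of
  \<open>f\<close> near \<open>p\<close>, and on an open set these are values on \<open>U\<close>.
  So agreement on \<open>U\<close> passes to the derivatives of every order.\<close>

lemma Ck_on_cong:
  assumes "open U" "\<And>p. p \<in> U \<Longrightarrow> f p = g p" "Ck_on k U f"
  shows "Ck_on k U g"
  using assms
proof (induction k arbitrary: f g)
  case 0
  then show ?case using continuous_on_cong[of U U f g] by simp
next
  case (Suc k)
  have f: "f differentiable (at p)" if "p \<in> U" for p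
    using Suc.prems that by (simp add: differentiable_on_eq_differentiable_at)
  have eq: "frechet_derivative f (at p) = frechet_derivative g (at p)" if "p \<in> U" for p
    using frechet_derivative_transform_within_open[OF f[OF that] Suc.prems(1) that] Suc.prems(2)
    by simp
  have "g differentiable_on U"
    unfolding differentiable_on_def
  proof
    fix p assume p: "p \<in> U"
    show "g differentiable (at p within U)"
      by (rule differentiable_transform_within[of f p U 1])
        (use f[OF p] p Suc.prems(2) in \<open>auto intro: differentiable_at_withinI\<close>)
  qed
  moreover have "Ck_on k U (\<lambda>p. frechet_derivative g (at p) v)" for v
    by (rule Suc.IH[of "\<lambda>p. frechet_derivative f (at p) v"]) (use Suc.prems eq in auto)
  ultimately show ?case by simp
qed

lemma Ck_on_subset: "Ck_on k U f \<Longrightarrow> V \<subseteq> U \<Longrightarrow> Ck_on k V f"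
  by (induction k arbitrary: f)
    (auto intro: continuous_on_subset differentiable_on_subset)

lemma Ck_on_Suc_imp: "Ck_on (Suc k) U f \<Longrightarrow> Ck_on k U f"
  by (induction k arbitrary: f) (auto intro: differentiable_imp_continuous_on)

lemma frechet_derivative_eqI:
  "(f has_derivative f') (at p) \<Longrightarrow> frechet_derivative f (at p) v = f' v"
  using frechet_derivative_at by metis

lemma Ck_on_add:
  assumes "open U"
  shows "Ck_on k U f \<Longrightarrow> Ck_on k U g \<Longrightarrow> Ck_on k U (\<lambda>p. f p + g p)"
proof (induction k arbitrary: f g)
  case 0
  then show ?case by (simp add: continuous_on_add)
next
  case (Suc k)
  have d: "f differentiable (at p)" "g differentiable (at p)" if "p \<in> U" for p
    using Suc.prems assms that by (simp_all add: differentiable_on_eq_differentiable_at)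
  have "frechet_derivative (\<lambda>p. f p + g p) (at p) v =
      frechet_derivative f (at p) v + frechet_derivative g (at p) v" if "p \<in> U" for p v
    by (rule frechet_derivative_eqI)
      (use d[OF that] in \<open>simp add: frechet_derivative_works has_derivative_add\<close>)
  moreover have "Ck_on k U (\<lambda>p. frechet_derivative f (at p) v + frechet_derivative g (at p) v)" for v
    using Suc by simp
  ultimately have "Ck_on k U (\<lambda>p. frechet_derivative (\<lambda>p. f p + g p) (at p) v)" for v
    using Ck_on_cong[OF assms, of "\<lambda>p. frechet_derivative f (at p) v + frechet_derivative g (at p) v"]
    by simp
  then show ?case using Suc.prems by (simp add: differentiable_on_add)
qed

text \<open>By the Leibniz rule the derivative is a sum of two products of the same kind, which
  keeps the induction going. The generality covers scalar, inner, Minkowski and wedge products at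
  once.\<close>

lemma (in bounded_bilinear) Ck_on:
  assumes "open U"
  shows "Ck_on k U f \<Longrightarrow> Ck_on k U g \<Longrightarrow> Ck_on k U (\<lambda>p. prod (f p) (g p))"
proof (induction k arbitrary: f g)
  case 0
  then show ?case by (simp add: continuous_on)
next
  case (Suc k)
  have d: "(f has_derivative frechet_derivative f (at p)) (at p)"
      "(g has_derivative frechet_derivative g (at p)) (at p)" if "p \<in> U" for p
    using Suc.prems assms that by (simp_all add: differentiable_on_eq_differentiable_at flip: frechet_derivative_works)
  note D = FDERIV[OF d]
  have "Ck_on k U (\<lambda>p. prod (f p) (frechet_derivative g (at p) v)
      + prod (frechet_derivative f (at p) v) (g p))" for v
    using Suc.prems Suc.prems[THEN Ck_on_Suc_imp]
    by (intro Ck_on_add[OF assms] Suc.IH) simp_all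
  then have "Ck_on k U (\<lambda>p. frechet_derivative (\<lambda>p. prod (f p) (g p)) (at p) v)" for v
    by (rule Ck_on_cong[OF assms, rotated]) (rule frechet_derivative_eqI[OF D, symmetric])
  moreover have "(\<lambda>p. prod (f p) (g p)) differentiable_on U"
    unfolding differentiable_on_def
  proof
    fix p assume p: "p \<in> U"
    show "(\<lambda>p. prod (f p) (g p)) differentiable (at p within U)"
      by (rule differentiable_at_withinI[OF differentiableI[OF D[OF p p]]])
  qed
  ultimately show ?case by simp
qed

lemma Ck_on_const [simp]: "Ck_on k U (\<lambda>p. c)"
  by (induction k arbitrary: c) simp_all

lemma smooth_on_cong:
  "open U \<Longrightarrow> (\<And>p. p \<in> U \<Longrightarrow> f p = g p) \<Longrightarrow> smooth_on U f \<Longrightarrow> smooth_on U g"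
  unfolding smooth_on_def by (meson Ck_on_cong)

lemma smooth_on_subset: "smooth_on U f \<Longrightarrow> V \<subseteq> U \<Longrightarrow> smooth_on V f"
  unfolding smooth_on_def using Ck_on_subset by blast

lemma smooth_on_const: "smooth_on U (\<lambda>p. c)"
  by (simp add: smooth_on_def)

lemma smooth_on_add:
  "open U \<Longrightarrow> smooth_on U f \<Longrightarrow> smooth_on U g \<Longrightarrow> smooth_on U (\<lambda>p. f p + g p)"
  by (simp add: smooth_on_def Ck_on_add)

lemma (in bounded_bilinear) smooth_on:
  "open U \<Longrightarrow> smooth_on U f \<Longrightarrow> smooth_on U g \<Longrightarrow> smooth_on U (\<lambda>p. prod (f p) (g p))"
  by (simp add: smooth_on_def Ck_on)

lemma smooth_on_scaleR:
  "open U \<Longrightarrow> smooth_on U f \<Longrightarrow> smooth_on U g \<Longrightarrow> smooth_on U (\<lambda>p. f p *\<^sub>R g p)"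
  by (rule bounded_bilinear.smooth_on[OF bounded_bilinear_scaleR])

lemma smooth_on_mult:
  fixes f g :: "_ \<Rightarrow> 'a::real_normed_algebra"
  shows "open U \<Longrightarrow> smooth_on U f \<Longrightarrow> smooth_on U g \<Longrightarrow> smooth_on U (\<lambda>p. f p * g p)"
  by (rule bounded_bilinear.smooth_on[OF bounded_bilinear_mult])

lemma smooth_on_inner:
  "open U \<Longrightarrow> smooth_on U f \<Longrightarrow> smooth_on U g \<Longrightarrow> smooth_on U (\<lambda>p. f p \<bullet> g p)"
  by (rule bounded_bilinear.smooth_on[OF bounded_bilinear_inner])

lemma smooth_on_minus: "open U \<Longrightarrow> smooth_on U f \<Longrightarrow> smooth_on U (\<lambda>p. - f p)"
  using smooth_on_scaleR[of U "\<lambda>p. -1" f] by (simp add: smooth_on_const)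

lemma smooth_on_diff:
  "open U \<Longrightarrow> smooth_on U f \<Longrightarrow> smooth_on U g \<Longrightarrow> smooth_on U (\<lambda>p. f p - g p)"
  using smooth_on_add[of U f "\<lambda>p. - g p"] by (simp add: smooth_on_minus)

lemma smooth_on_sum:
  "open U \<Longrightarrow> (\<And>i. i \<in> I \<Longrightarrow> smooth_on U (f i)) \<Longrightarrow> smooth_on U (\<lambda>p. \<Sum>i\<in>I. f i p)"
  by (induction I rule: infinite_finite_induct) (simp_all add: smooth_on_const smooth_on_add)

lemma smooth_on_frechet_derivative:
  "smooth_on U f \<Longrightarrow> smooth_on U (\<lambda>p. frechet_derivative f (at p) v)"
  unfolding smooth_on_def using Ck_on.simps(2) by blast

lemma smooth_on_has_derivative:
  "smooth_on U f \<Longrightarrow> open U \<Longrightarrow> p \<in> U \<Longrightarrow> (f has_derivative frechet_derivative f (at p)) (at p)"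
  using Ck_on.simps(2)[of 0 U f]
  by (simp add: smooth_on_def differentiable_on_eq_differentiable_at flip: frechet_derivative_works)

lemma smooth_on_continuous_on: "smooth_on U f \<Longrightarrow> continuous_on U f"
  using Ck_on.simps(1) unfolding smooth_on_def by blast

lemma frechet_derivative_Basis:
  assumes "(f has_derivative frechet_derivative f (at p)) (at p)"
  shows "frechet_derivative f (at p) v = (\<Sum>b\<in>Basis. (v \<bullet> b) *\<^sub>R frechet_derivative f (at p) b)"
proof -
  interpret bounded_linear "frechet_derivative f (at p)"
    using assms by (rule has_derivative_bounded_linear)
  have "frechet_derivative f (at p) v = frechet_derivative f (at p) (\<Sum>b\<in>Basis. (v \<bullet> b) *\<^sub>R b)"
    by (simp add: euclidean_representation)
  then show ?thesis by (simp add: sum scaleR)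
qed

lemma smooth_on_along:
  assumes "open U" "smooth_on U X" "smooth_on U f"
  shows "smooth_on U (along X f)"
proof (rule smooth_on_cong[OF assms(1)])
  \<comment> \<open>\<open>Ck_on\<close> speaks of derivatives in fixed directions only, so the
    variable direction \<open>X p\<close> is expanded in the standard basis.\<close>
  show "smooth_on U (\<lambda>p. \<Sum>b\<in>Basis. (X p \<bullet> b) *\<^sub>R frechet_derivative f (at p) b)"
    using assms by (intro smooth_on_sum smooth_on_scaleR smooth_on_inner
      smooth_on_const smooth_on_frechet_derivative)
  show "(\<Sum>b\<in>Basis. (X p \<bullet> b) *\<^sub>R frechet_derivative f (at p) b) = along X f p" if "p \<in> U" for p
    using frechet_derivative_Basis[OF smooth_on_has_derivative[OF assms(3,1) that]]
    by (metis along_def)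
qed

section \<open>Symmetry of second derivatives\<close>

lemma second_difference_mean_value:
  fixes f :: "'a::euclidean_space \<Rightarrow> real"
  assumes "open U" "smooth_on U f" "h > 0"
    and U: "\<And>s t. 0 \<le> s \<Longrightarrow> s \<le> h \<Longrightarrow> 0 \<le> t \<Longrightarrow> t \<le> h \<Longrightarrow> p + s *\<^sub>R v + t *\<^sub>R w \<in> U"
  shows "\<exists>s t. 0 < s \<and> s < h \<and> 0 < t \<and> t < h \<and>
    f (p + h *\<^sub>R v + h *\<^sub>R w) - f (p + h *\<^sub>R v) - (f (p + h *\<^sub>R w) - f p) =
    h * (h * frechet_derivative (\<lambda>q. frechet_derivative f (at q) v) (at (p + s *\<^sub>R v + t *\<^sub>R w)) w)"
proof -
  have dv: "((\<lambda>s. g (q + s *\<^sub>R u)) has_field_derivative frechet_derivative g (at (q + s *\<^sub>R u)) u) (at s)"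
    if g: "smooth_on U g" "q + s *\<^sub>R u \<in> U" for g :: "'a \<Rightarrow> real" and q u s
  proof -
    note D = smooth_on_has_derivative[OF g(1) assms(1) g(2)]
    interpret bounded_linear "frechet_derivative g (at (q + s *\<^sub>R u))"
      using D by (rule has_derivative_bounded_linear)
    have "((\<lambda>s. g (q + s *\<^sub>R u)) has_derivative
        (\<lambda>d. frechet_derivative g (at (q + s *\<^sub>R u)) (d *\<^sub>R u))) (at s)"
      by (rule has_derivative_compose[of "\<lambda>s. q + s *\<^sub>R u" "\<lambda>d. d *\<^sub>R u", OF _ D])
        (auto intro!: derivative_eq_intros)
    then show ?thesis
      unfolding has_field_derivative_def
      by (rule has_derivative_eq_rhs) (simp add: fun_eq_iff scaleR)
  qed
  let ?F = "\<lambda>q. frechet_derivative f (at q) v"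
  \<comment> \<open>The second difference is the increment, along \<open>v\<close>, of a first
    difference in direction \<open>w\<close>. The mean value theorem in \<open>s\<close> brings in
    the derivative along \<open>v\<close>; a second use, in \<open>t\<close>, turns the remaining
    difference along \<open>w\<close> into the mixed derivative.\<close>
  have "\<exists>s>0. s < h \<and> (f ((p + h *\<^sub>R w) + h *\<^sub>R v) - f (p + h *\<^sub>R v))
      - (f ((p + h *\<^sub>R w) + 0 *\<^sub>R v) - f (p + 0 *\<^sub>R v)) =
      (h - 0) * (?F ((p + h *\<^sub>R w) + s *\<^sub>R v) - ?F (p + s *\<^sub>R v))"
  proof (rule MVT2[OF assms(3)])
    fix s assume "0 \<le> s" "s \<le> h"
    then show "((\<lambda>s. f ((p + h *\<^sub>R w) + s *\<^sub>R v) - f (p + s *\<^sub>R v)) has_field_derivative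
        ?F ((p + h *\<^sub>R w) + s *\<^sub>R v) - ?F (p + s *\<^sub>R v)) (at s)"
      using U[of s h] U[of s 0] assms(3)
      by (intro DERIV_diff dv assms(2)) (auto simp: algebra_simps)
  qed
  then obtain s where s: "0 < s" "s < h"
    and eq: "f (p + h *\<^sub>R w + h *\<^sub>R v) - f (p + h *\<^sub>R v) - (f (p + h *\<^sub>R w) - f p) =
      h * (?F (p + h *\<^sub>R w + s *\<^sub>R v) - ?F (p + s *\<^sub>R v))" by auto
  have "\<exists>t>0. t < h \<and> ?F ((p + s *\<^sub>R v) + h *\<^sub>R w) - ?F ((p + s *\<^sub>R v) + 0 *\<^sub>R w) =
      (h - 0) * frechet_derivative ?F (at ((p + s *\<^sub>R v) + t *\<^sub>R w)) w"
  proof (rule MVT2[OF assms(3)])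
    fix t assume "0 \<le> t" "t \<le> h"
    then show "((\<lambda>t. ?F ((p + s *\<^sub>R v) + t *\<^sub>R w)) has_field_derivative
        frechet_derivative ?F (at ((p + s *\<^sub>R v) + t *\<^sub>R w)) w) (at t)"
      using U[of s t] s by (intro dv smooth_on_frechet_derivative assms(2)) auto
  qed
  then obtain t where "0 < t" "t < h" "?F (p + s *\<^sub>R v + h *\<^sub>R w) - ?F (p + s *\<^sub>R v) =
      h * frechet_derivative ?F (at (p + s *\<^sub>R v + t *\<^sub>R w)) w" by auto
  with s eq show ?thesis
    by (intro exI[of _ s] exI[of _ t]) (simp add: algebra_simps)
qed

text \<open>The second difference over a small parallelogram is symmetric in \<open>v\<close> and
  \<open>w\<close>, and it equals \<open>h * h\<close> times either mixed derivative at some point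
  of the parallelogram. By continuity both are close to their values at \<open>p\<close>, so these
  cannot differ.\<close>

lemma frechet_derivative_commute_real:
  fixes f :: "'a::euclidean_space \<Rightarrow> real"
  assumes "open U" "smooth_on U f" "p \<in> U"
  shows "frechet_derivative (\<lambda>q. frechet_derivative f (at q) v) (at p) w =
    frechet_derivative (\<lambda>q. frechet_derivative f (at q) w) (at p) v"
proof (rule ccontr)
  let ?D = "\<lambda>v w q. frechet_derivative (\<lambda>q. frechet_derivative f (at q) v) (at q) w"
  assume ne: "?D v w p \<noteq> ?D w v p"
  define e where "e = \<bar>?D v w p - ?D w v p\<bar> / 2"
  have "e > 0" using ne by (simp add: e_def)
  have cont: "isCont (?D v w) p" for v w
    using smooth_on_continuous_on[OF smooth_on_frechet_derivative[OF
      smooth_on_frechet_derivative[OF assms(2)]], of v w] assms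
    by (simp add: continuous_on_eq_continuous_at)
  obtain d1 where d1: "d1 > 0" "\<And>q. dist q p < d1 \<Longrightarrow> dist (?D v w q) (?D v w p) < e"
    using cont[of v w] \<open>e > 0\<close> unfolding continuous_at_eps_delta by (metis)
  obtain d2 where d2: "d2 > 0" "\<And>q. dist q p < d2 \<Longrightarrow> dist (?D w v q) (?D w v p) < e"
    using cont[of w v] \<open>e > 0\<close> unfolding continuous_at_eps_delta by (metis)
  obtain d3 where d3: "d3 > 0" "ball p d3 \<subseteq> U"
    using assms open_contains_ball by blast
  define d where "d = min d1 (min d2 d3)"
  have "d > 0" using d1 d2 d3 by (simp add: d_def)
  \<comment> \<open>This scale puts the whole parallelogram into the ball of radius
    \<open>d\<close>. The summand 1 keeps the denominator positive when \<open>v\<close> and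
    \<open>w\<close> vanish.\<close>
  define h where "h = d / (norm v + norm w + 1)"
  have pos: "norm v + norm w + 1 > 0" by (smt (verit) norm_ge_zero)
  have "h > 0" using \<open>d > 0\<close> pos by (simp add: h_def)
  have near: "dist (p + s *\<^sub>R v + t *\<^sub>R w) p < d" if "0 \<le> s" "s \<le> h" "0 \<le> t" "t \<le> h" for s t
  proof -
    have "dist (p + s *\<^sub>R v + t *\<^sub>R w) p = norm (s *\<^sub>R v + t *\<^sub>R w)"
      by (simp add: dist_norm)
    also have "\<dots> \<le> s * norm v + t * norm w"
      using that norm_triangle_ineq[of "s *\<^sub>R v" "t *\<^sub>R w"] by simp
    also have "\<dots> \<le> h * norm v + h * norm w"
      using that by (intro add_mono mult_right_mono) auto
    also have "\<dots> < h * (norm v + norm w + 1)"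
      using \<open>h > 0\<close> by (simp add: algebra_simps)
    also have "\<dots> = d" using pos by (simp add: h_def)
    finally show ?thesis .
  qed
  have near': "dist (p + s *\<^sub>R w + t *\<^sub>R v) p < d" if "0 \<le> s" "s \<le> h" "0 \<le> t" "t \<le> h" for s t
    using near[of t s] that by (simp add: algebra_simps)
  have inU: "q \<in> U" if "dist q p < d" for q
    using that d3 by (auto simp: d_def dist_commute)
  obtain s t where st: "0 < s" "s < h" "0 < t" "t < h" and
    1: "f (p + h *\<^sub>R v + h *\<^sub>R w) - f (p + h *\<^sub>R v) - (f (p + h *\<^sub>R w) - f p) =
      h * (h * ?D v w (p + s *\<^sub>R v + t *\<^sub>R w))"
    using second_difference_mean_value[OF assms(1,2) \<open>h > 0\<close>, of p v w] near inU by blast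
  obtain s' t' where st': "0 < s'" "s' < h" "0 < t'" "t' < h" and
    2: "f (p + h *\<^sub>R w + h *\<^sub>R v) - f (p + h *\<^sub>R w) - (f (p + h *\<^sub>R v) - f p) =
      h * (h * ?D w v (p + s' *\<^sub>R w + t' *\<^sub>R v))"
    using second_difference_mean_value[OF assms(1,2) \<open>h > 0\<close>, of p w v] near' inU by blast
  have "p + h *\<^sub>R w + h *\<^sub>R v = p + h *\<^sub>R v + h *\<^sub>R w" by simp
  then have "h * (h * ?D v w (p + s *\<^sub>R v + t *\<^sub>R w)) = h * (h * ?D w v (p + s' *\<^sub>R w + t' *\<^sub>R v))"
    unfolding 1[symmetric] 2[symmetric] by (simp add: add_ac)
  then have "?D v w (p + s *\<^sub>R v + t *\<^sub>R w) = ?D w v (p + s' *\<^sub>R w + t' *\<^sub>R v)"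
    using \<open>h > 0\<close> by simp
  moreover have "dist (?D v w (p + s *\<^sub>R v + t *\<^sub>R w)) (?D v w p) < e"
    using near[of s t] st by (intro d1) (simp add: d_def)
  moreover have "dist (?D w v (p + s' *\<^sub>R w + t' *\<^sub>R v)) (?D w v p) < e"
    using near'[of s' t'] st' by (intro d2) (simp add: d_def)
  ultimately show False
    unfolding e_def dist_real_def by (smt (verit) field_sum_of_halves)
qed

lemma frechet_derivative_inner_left:
  assumes "(f has_derivative frechet_derivative f (at p)) (at p)"
  shows "frechet_derivative (\<lambda>q. f q \<bullet> b) (at p) v = frechet_derivative f (at p) v \<bullet> b"
  by (rule frechet_derivative_eqI)
    (use assms in \<open>auto intro!: derivative_eq_intros\<close>)

theorem frechet_derivative_commute:
  fixes f :: "'a::euclidean_space \<Rightarrow> 'b::euclidean_space"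
  assumes "open U" "smooth_on U f" "p \<in> U"
  shows "frechet_derivative (\<lambda>q. frechet_derivative f (at q) v) (at p) w =
    frechet_derivative (\<lambda>q. frechet_derivative f (at q) w) (at p) v"
proof (rule euclidean_eqI)
  fix b :: 'b assume "b \<in> Basis"
  let ?fb = "\<lambda>q. f q \<bullet> b"
  have 1: "frechet_derivative (\<lambda>q. frechet_derivative f (at q) v) (at p) w \<bullet> b =
      frechet_derivative (\<lambda>q. frechet_derivative ?fb (at q) v) (at p) w" for v w
  proof -
    have "frechet_derivative (\<lambda>q. frechet_derivative ?fb (at q) v) (at p) =
        frechet_derivative (\<lambda>q. frechet_derivative f (at q) v \<bullet> b) (at p)"
    proof (rule frechet_derivative_transform_within_open[OF _ assms(1,3), symmetric])
      show "(\<lambda>q. frechet_derivative f (at q) v \<bullet> b) differentiable at p"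
        using smooth_on_has_derivative[OF smooth_on_inner[OF assms(1)
          smooth_on_frechet_derivative[OF assms(2)] smooth_on_const] assms(1,3)]
        by (rule differentiableI)
      show "frechet_derivative f (at q) v \<bullet> b = frechet_derivative ?fb (at q) v" if "q \<in> U" for q
        by (rule frechet_derivative_inner_left[symmetric])
          (rule smooth_on_has_derivative[OF assms(2,1) that])
    qed
    then show ?thesis
      using frechet_derivative_inner_left[OF smooth_on_has_derivative[OF
        smooth_on_frechet_derivative[OF assms(2)] assms(1,3)]] by simp
  qed
  show "frechet_derivative (\<lambda>q. frechet_derivative f (at q) v) (at p) w \<bullet> b =
      frechet_derivative (\<lambda>q. frechet_derivative f (at q) w) (at p) v \<bullet> b"
    unfolding 1
    by (rule frechet_derivative_commute_real[OF assms(1) _ assms(3)])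
      (rule smooth_on_inner[OF assms(1,2) smooth_on_const])
qed

subsection \<open>Bivectors of Minkowski space\<close>

lemma bilinear_minkowski: "bilinear minkowski"
  by (auto simp: bilinear_def linear_iff minkowski_def algebra_simps)

global_interpretation minkowski: bounded_bilinear minkowski
  using bilinear_minkowski by (simp add: bilinear_conv_bounded_bilinear)

lemma bilinear_wedge: "bilinear wedge"
  by (auto simp: bilinear_def linear_iff wedge_def vec_eq_iff algebra_simps)

global_interpretation wedge: bounded_bilinear wedge
  using bilinear_wedge by (simp add: bilinear_conv_bounded_bilinear)

lemma minkowski_commute: "minkowski v w = minkowski w v"
  by (simp add: minkowski_def algebra_simps)

lemma wedge_self [simp]: "wedge v v = 0"
  by (simp add: wedge_def vec_eq_iff)

text \<open>The value at \<open>v, w\<close> is the product of \<open>W\<close> with \<open>wedge v w\<close> in the determinant metric.\<close>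

definition bivector_form :: "real^4^4 \<Rightarrow> real^4 \<Rightarrow> real^4 \<Rightarrow> real" where
  "bivector_form W v w = minkowski v (\<chi> i. minkowski (W $ i) w)"

lemma bivector_form_wedge:
  "bivector_form (wedge a b) v w = minkowski a v * minkowski b w - minkowski b v * minkowski a w"
  by (simp add: bivector_form_def wedge_def minkowski_def algebra_simps)

lemma linear_bivector_form: "linear (\<lambda>W. bivector_form W v w)"
  by (simp add: linear_iff bivector_form_def minkowski_def algebra_simps)

lemma bivector_form_add: "bivector_form (W + W') v w = bivector_form W v w + bivector_form W' v w"
  and bivector_form_diff: "bivector_form (W - W') v w = bivector_form W v w - bivector_form W' v w"
  and bivector_form_scaleR: "bivector_form (c *\<^sub>R W) v w = c * bivector_form W v w"
  using linear_add[OF linear_bivector_form[of v w], of W W']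
    linear_diff[OF linear_bivector_form[of v w], of W W']
    linear_scale[OF linear_bivector_form[of v w], of c W]
  by simp_all

lemma bilinear_bivector_form: "bilinear (bivector_form W)"
  by (simp add: bilinear_def linear_iff bivector_form_def minkowski_def algebra_simps)

lemma bivector_form_axis:
  "bivector_form W (axis i 1) (axis j 1) =
    (if i = 1 then -1 else 1) * (if j = 1 then -1 else 1) * W $ i $ j"
proof -
  have "minkowski (axis k 1) v = (if k = 1 then -1 else 1) * v $ k" for k v
    using exhaust_4[of k] by (auto simp: minkowski_def axis_def)
  then show ?thesis
    by (simp add: bivector_form_def minkowski_commute[of _ "axis j 1"])
qed

text \<open>Evaluation at the standard basis vectors returns the entries up to sign. Bivectors can
  therefore be compared by their values on pairs of vectors.\<close>

lemma bivector_form_inject: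
  assumes "\<And>v w. bivector_form W v w = bivector_form W' v w"
  shows "W = W'"
proof -
  have "W $ i $ j = W' $ i $ j" for i j
    using assms[of "axis i 1" "axis j 1"] by (simp add: bivector_form_axis split: if_splits)
  then show ?thesis by (simp add: vec_eq_iff)
qed

section \<open>The Hodge star and orthonormal frames\<close>

lemma det_4:
  "det (A::'a::comm_ring_1^4^4) =
    A$1$1 * (A$2$2 * (A$3$3 * A$4$4 - A$3$4 * A$4$3) - A$2$3 * (A$3$2 * A$4$4 - A$3$4 * A$4$2)
      + A$2$4 * (A$3$2 * A$4$3 - A$3$3 * A$4$2)) -
    A$1$2 * (A$2$1 * (A$3$3 * A$4$4 - A$3$4 * A$4$3) - A$2$3 * (A$3$1 * A$4$4 - A$3$4 * A$4$1)
      + A$2$4 * (A$3$1 * A$4$3 - A$3$3 * A$4$1)) +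
    A$1$3 * (A$2$1 * (A$3$2 * A$4$4 - A$3$4 * A$4$2) - A$2$2 * (A$3$1 * A$4$4 - A$3$4 * A$4$1)
      + A$2$4 * (A$3$1 * A$4$2 - A$3$2 * A$4$1)) -
    A$1$4 * (A$2$1 * (A$3$2 * A$4$3 - A$3$3 * A$4$2) - A$2$2 * (A$3$1 * A$4$3 - A$3$3 * A$4$1)
      + A$2$3 * (A$3$1 * A$4$2 - A$3$2 * A$4$1))"
proof -
  have f1234: "finite {2::4, 3, 4}" "1 \<notin> {2::4, 3, 4}"
    by auto
  have f234: "finite {3::4, 4}" "2 \<notin> {3::4, 4}"
    by auto
  have f34: "finite {4::4}" "3 \<notin> {4::4}"
    by auto
  show ?thesis
    unfolding det_def UNIV_4
    unfolding sum_over_permutations_insert[OF f1234]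
    unfolding sum_over_permutations_insert[OF f234]
    unfolding sum_over_permutations_insert[OF f34]
    unfolding permutes_sing
    by (simp add: sign_swap_id permutation_swap_id permutation_compose sign_compose sign_id
      swap_id_eq algebra_simps)
qed

text \<open>The sign is chosen such that \<open>wedge (e 1) (e 2)\<close> goes to \<open>wedge (e 3) (e 4)\<close>.\<close>

definition hodge :: "real^4^4 \<Rightarrow> real^4^4" where
  "hodge W = (\<chi> i j.
     if i = 1 then (if j = 2 then W$3$4 else if j = 3 then - W$2$4 else if j = 4 then W$2$3 else 0)
     else if i = 2 then (if j = 1 then - W$3$4 else if j = 3 then - W$1$4 else if j = 4 then W$1$3 else 0)
     else if i = 3 then (if j = 1 then W$2$4 else if j = 2 then W$1$4 else if j = 4 then - W$1$2 else 0)
     else (if j = 1 then - W$2$3 else if j = 2 then - W$1$3 else if j = 3 then W$1$2 else 0))"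

lemma linear_hodge: "linear hodge"
  by (auto simp: linear_iff hodge_def vec_eq_iff)

text \<open>The minus sign reflects the single negative direction of the metric. The identity serves
  to recover the area bivector from the Gauss map.\<close>

lemma hodge_hodge_wedge: "hodge (hodge (wedge v w)) = - wedge v w"
  by (simp add: hodge_def wedge_def vec_eq_iff forall_4)

definition rows_4 :: "real^4 \<Rightarrow> real^4 \<Rightarrow> real^4 \<Rightarrow> real^4 \<Rightarrow> real^4^4" where
  "rows_4 a b c d = (\<chi> i. if i = 1 then a else if i = 2 then b else if i = 3 then c else d)"

text \<open>A coordinate-free characterization of \<open>hodge\<close>, by which its definition in
  coordinates can be evaluated in an arbitrary frame.\<close>

lemma bivector_form_hodge_wedge:
  "bivector_form (hodge (wedge a b)) v w = - det (rows_4 a b v w)"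
  by (simp add: bivector_form_def hodge_def wedge_def minkowski_def det_4 rows_4_def algebra_simps)

lemma rows_4_eta: "(\<chi> i. e i) = rows_4 (e 1) (e 2) (e 3) (e 4)"
  by (simp add: rows_4_def vec_eq_iff forall_4)

text \<open>The Gram matrix of the rows factors through the diagonal matrix \<open>J\<close> of the
  metric, and \<open>det J = - 1\<close>.\<close>

lemma det_gram:
  fixes F :: "real^4^4"
  shows "det (\<chi> i j. minkowski (F $ i) (F $ j)) = - (det F)\<^sup>2"
proof -
  define J :: "real^4^4" where "J = (\<chi> i j. if i = j then if i = 1 then -1 else 1 else 0)"
  have "det J = - 1"
    by (subst det_diagonal) (simp_all add: J_def)
  moreover have "(\<chi> i j. minkowski (F $ i) (F $ j)) = F ** (J ** transpose F)"
  proof -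
    have "minkowski (F $ i) (F $ j) = (\<Sum>k\<in>UNIV. F $ i $ k * (\<Sum>l\<in>UNIV. J $ k $ l * F $ j $ l))" for i j
      unfolding sum_4 by (simp add: J_def minkowski_def)
    then show ?thesis
      by (simp add: matrix_matrix_mult_def transpose_def)
  qed
  ultimately show ?thesis
    by (simp add: det_mul power2_eq_square)
qed

text \<open>The Gram matrix is diagonal with entries of absolute value 1, so \<open>det_gram\<close>
  leaves only these values.\<close>

lemma orthonormal_det:
  fixes e :: "4 \<Rightarrow> real^4"
  assumes orth: "\<And>i j. i \<noteq> j \<Longrightarrow> minkowski (e i) (e j) = 0"
    and unit: "\<And>i. \<bar>minkowski (e i) (e i)\<bar> = 1"
  shows "(det (\<chi> i. e i))\<^sup>2 = 1" (is ?det)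
    and "(\<Prod>i\<in>UNIV. minkowski (e i) (e i)) = - 1" (is ?prod)
proof -
  have 1: "(\<Prod>i\<in>UNIV. minkowski (e i) (e i)) = - (det (\<chi> i. e i))\<^sup>2"
    using det_gram[of "\<chi> i. e i"] by (subst (asm) det_diagonal) (auto simp: orth)
  have "\<bar>\<Prod>i\<in>UNIV. minkowski (e i) (e i)\<bar> = 1"
    by (simp add: abs_prod unit)
  with 1 show ?det by simp
  with 1 show ?prod by simp
qed

lemma prod_4: "prod f (UNIV :: 4 set) = f 1 * f 2 * f 3 * f 4"
  unfolding UNIV_4 by (simp add: ac_simps)

text \<open>Both sides are compared on pairs of frame vectors. They vanish except on
  \<open>e 3\<close> and \<open>e 4\<close>; there one side is the product of the squares of the two
  normal vectors and the other is minus the determinant of the frame, and both are -1.\<close>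

lemma wedge_normal_eq_hodge:
  fixes e :: "4 \<Rightarrow> real^4"
  assumes orth: "\<And>i j. i \<noteq> j \<Longrightarrow> minkowski (e i) (e j) = 0"
    and unit: "\<And>i. \<bar>minkowski (e i) (e i)\<bar> = 1"
    and "minkowski (e 1) (e 1) = 1" "minkowski (e 2) (e 2) = 1"
    and pos: "0 < det (\<chi> i. e i)"
  shows "wedge (e 3) (e 4) = hodge (wedge (e 1) (e 2))"
proof (rule bivector_form_inject)
  fix v w
  have det: "det (\<chi> i. e i) = 1"
    using orthonormal_det(1)[of e, OF orth unit] pos by (simp add: power2_eq_1_iff)
  have 34: "minkowski (e 3) (e 3) * minkowski (e 4) (e 4) = - 1"
    using orthonormal_det(2)[of e, OF orth unit] assms(3,4) by (simp add: prod_4)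
  have "invertible (\<chi> i. e i)"
    using det by (simp add: invertible_det_nz)
  then have span: "span (range e) = UNIV"
    using matrix_left_invertible_span_rows[of "\<chi> i. e i"]
    by (auto simp: invertible_def rows_def row_def full_SetCompr_eq)
  show "bivector_form (wedge (e 3) (e 4)) v w = bivector_form (hodge (wedge (e 1) (e 2))) v w"
  proof (rule bilinear_eq[OF bilinear_bivector_form bilinear_bivector_form])
    show "(UNIV :: (real^4) set) \<subseteq> span (range e)" "(UNIV :: (real^4) set) \<subseteq> span (range e)"
      using span by auto
    fix x y assume "x \<in> range e" "y \<in> range e"
    then obtain i j where x: "x = e i" and y: "y = e j" by auto
    have alt: "det (rows_4 a b c d) = 0" if "a = c \<or> a = d \<or> b = c \<or> b = d \<or> c = d" for a b c d
      using that by (auto simp: det_4 rows_4_def algebra_simps)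
    have anti: "det (rows_4 a b d c) = - det (rows_4 a b c d)" for a b c d
      by (simp add: det_4 rows_4_def algebra_simps)
    show "bivector_form (wedge (e 3) (e 4)) x y = bivector_form (hodge (wedge (e 1) (e 2))) x y"
      unfolding x y bivector_form_hodge_wedge bivector_form_wedge
      using exhaust_4[of i] exhaust_4[of j] 34 det
      by (elim disjE)
        (simp_all add: orth alt anti[of _ _ "e 3" "e 4"] rows_4_eta mult.commute)
  qed auto
qed

section \<open>Completing a tangent frame by normal vectors\<close>

lemma reverse_cauchy_schwarz:
  assumes "minkowski t t < 0" "minkowski t v = 0" "v \<noteq> 0"
  shows "minkowski v v > 0"
proof -
  define T where "T = (t$2)\<^sup>2 + (t$3)\<^sup>2 + (t$4)\<^sup>2"
  define X where "X = (v$2)\<^sup>2 + (v$3)\<^sup>2 + (v$4)\<^sup>2"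
  have t1: "T < (t$1)\<^sup>2"
    using assms(1) by (simp add: T_def minkowski_def power2_eq_square)
  have T0: "0 \<le> T" by (simp add: T_def)
  have eq: "t$1 * v$1 = t$2 * v$2 + t$3 * v$3 + t$4 * v$4"
    using assms(2) by (simp add: minkowski_def)
  \<comment> \<open>Lagrange's identity, that is, the Cauchy-Schwarz inequality for the space parts,
    whose squared lengths are \<open>T\<close> and \<open>X\<close>.\<close>
  have "T * X - (t$2 * v$2 + t$3 * v$3 + t$4 * v$4)\<^sup>2 =
      (t$2 * v$3 - t$3 * v$2)\<^sup>2 + (t$2 * v$4 - t$4 * v$2)\<^sup>2 + (t$3 * v$4 - t$4 * v$3)\<^sup>2"
    unfolding T_def X_def by algebra
  then have le: "(t$1)\<^sup>2 * (v$1)\<^sup>2 \<le> T * X"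
    unfolding power_mult_distrib[symmetric] eq by (smt (verit) zero_le_power2)
  have "X > 0"
  proof (rule ccontr)
    assume "\<not> X > 0"
    then have "X = 0" and 0: "v$2 = 0" "v$3 = 0" "v$4 = 0"
      unfolding X_def by (smt (verit) zero_le_power2 zero_eq_power2)+
    with eq t1 T0 have "v$1 = 0" by auto
    with 0 assms(3) show False by (simp add: vec_eq_iff forall_4)
  qed
  then have "T * X < (t$1)\<^sup>2 * X" using t1 by simp
  with le have "(t$1)\<^sup>2 * (v$1)\<^sup>2 < (t$1)\<^sup>2 * X" by linarith
  then have "(v$1)\<^sup>2 < X"
    by (rule mult_left_less_imp_less) simp
  then show ?thesis by (simp add: X_def minkowski_def power2_eq_square)
qed

text \<open>Removing the tangential part of the time axis leaves a time-like normal vector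
  \<open>t\<close>. A dimension count supplies a vector outside the span of \<open>a\<close>,
  \<open>b\<close>, \<open>t\<close>; Gram-Schmidt turns it into \<open>n\<close>, which is
  space-like because it is orthogonal to \<open>t\<close>.\<close>

lemma ex_normal_frame:
  fixes a b :: "real^4"
  assumes a: "minkowski a a = 1" and b: "minkowski b b = 1" and ab: "minkowski a b = 0"
  obtains e :: "4 \<Rightarrow> real^4" where "e 1 = a" "e 2 = b"
    "\<And>i j. i \<noteq> j \<Longrightarrow> minkowski (e i) (e j) = 0"
    "\<And>i. \<bar>minkowski (e i) (e i)\<bar> = 1" "0 < det (\<chi> i. e i)"
proof -
  note bil = minkowski.add_left minkowski.add_right minkowski.diff_left minkowski.diff_right
    minkowski.scaleR_left minkowski.scaleR_right
  have ba: "minkowski b a = 0" using ab by (simp add: minkowski_commute)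
  define t0 :: "real^4" where "t0 = axis 1 1"
  define t where "t = t0 - minkowski t0 a *\<^sub>R a - minkowski t0 b *\<^sub>R b"
  have t0: "minkowski t0 t0 = - 1"
    by (simp add: t0_def minkowski_def axis_def)
  have ta: "minkowski t a = 0" "minkowski t b = 0"
    by (simp_all add: t_def bil a b ab ba)
  have "minkowski t t = - 1 - (minkowski t0 a)\<^sup>2 - (minkowski t0 b)\<^sup>2"
    by (simp add: t_def bil a b ab ba t0 minkowski_commute[of a t0] minkowski_commute[of b t0]
      power2_eq_square)
  then have tt: "minkowski t t < 0" by (smt (verit) zero_le_power2)
  have "card {a, b, t} \<le> 3" by (simp add: card_insert_le_m1)
  then have "dim {a, b, t} \<le> 3"
    using dim_le_card'[of "{a, b, t}"] by simp
  moreover have "dim {a, b, t} = 4" if "span {a, b, t} = UNIV"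
    using dim_span[of "{a, b, t}"] unfolding that by simp
  ultimately have "span {a, b, t} \<noteq> UNIV" by auto
  then obtain v where v: "v \<notin> span {a, b, t}" by auto
  define n where "n = v - minkowski v a *\<^sub>R a - minkowski v b *\<^sub>R b
    - (minkowski v t / minkowski t t) *\<^sub>R t"
  have "n \<noteq> 0"
  proof
    assume "n = 0"
    then have "v = minkowski v a *\<^sub>R a + minkowski v b *\<^sub>R b + (minkowski v t / minkowski t t) *\<^sub>R t"
      by (simp add: n_def algebra_simps)
    moreover have "\<dots> \<in> span {a, b, t}"
      by (intro span_add span_scale span_base) auto
    ultimately show False using v by simp
  qed
  have na: "minkowski n a = 0" "minkowski n b = 0" "minkowski n t = 0"
    using tt by (simp_all add: n_def bil a b ab ba ta minkowski_commute[of a t] minkowski_commute[of b t])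
  have nn: "minkowski n n > 0"
    using reverse_cauchy_schwarz[OF tt _ \<open>n \<noteq> 0\<close>] na by (simp add: minkowski_commute)
  \<comment> \<open>The sign \<open>s\<close> stays open until the end: changing it reverses one row
    and with it the determinant, so one of the two choices is positively oriented.\<close>
  define f where "f s = (\<lambda>i::4. if i = 1 then a else if i = 2 then b
    else if i = 3 then (s / sqrt (minkowski n n)) *\<^sub>R n else (1 / sqrt (- minkowski t t)) *\<^sub>R t)"
    for s :: real
  have orth: "minkowski (f s i) (f s j) = 0" if "i \<noteq> j" for s i j
    using that exhaust_4[of i] exhaust_4[of j]
    by (auto simp: f_def bil ab ba ta na minkowski_commute[of a t] minkowski_commute[of b t]
      minkowski_commute[of a n] minkowski_commute[of b n] minkowski_commute[of t n])
  have unit: "\<bar>minkowski (f s i) (f s i)\<bar> = 1" if "\<bar>s\<bar> = 1" for s i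
  proof -
    have "s * s = 1" using that by (metis abs_mult_self_eq mult_1)
    then show ?thesis
      using exhaust_4[of i] tt nn
      by (auto simp: f_def bil a b abs_mult real_sqrt_mult_self field_simps)
  qed
  have det: "det (\<chi> i. f (- 1) i) = - det (\<chi> i. f 1 i)"
    unfolding rows_4_eta by (simp add: rows_4_def det_4 f_def algebra_simps)
  have "det (\<chi> i. f 1 i) \<noteq> 0"
    using orthonormal_det(1)[of "f 1"] orth unit[of 1] by (simp add: power2_eq_1_iff) linarith
  then have "\<exists>s. \<bar>s\<bar> = 1 \<and> 0 < det (\<chi> i. f s i)"
    using det by (metis abs_1 abs_minus neg_0_less_iff_less not_less_iff_gr_or_eq)
  then obtain s where "\<bar>s\<bar> = 1" "0 < det (\<chi> i. f s i)" by auto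
  then show ?thesis
    using orth unit[of s] by (intro that[of "f s"]) (auto simp: f_def)
qed

subsection \<open>The Gauss map as the Hodge dual of the area bivector\<close>

lemma det_vector_2: "det (vector [a, b] :: real^2^2) = a$1 * b$2 - a$2 * b$1"
  by (simp add: det_2)

lemma linear_2_expand:
  fixes D :: "real^2 \<Rightarrow> 'a::real_vector"
  assumes "linear D"
  shows "D a = (a$1) *\<^sub>R D (axis 1 1) + (a$2) *\<^sub>R D (axis 2 1)"
proof -
  have "a = (a$1) *\<^sub>R axis 1 1 + (a$2) *\<^sub>R axis 2 1"
    by (simp add: vec_eq_iff forall_2 axis_def)
  then have "D a = D ((a$1) *\<^sub>R axis 1 1 + (a$2) *\<^sub>R axis 2 1)"
    by (rule arg_cong)
  then show ?thesis by (simp only: linear_add[OF assms] linear_scale[OF assms])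
qed

lemma wedge_linear_2:
  assumes "linear D"
  shows "wedge (D a) (D b) = det (vector [a, b] :: real^2^2) *\<^sub>R wedge (D (axis 1 1)) (D (axis 2 1))"
  unfolding linear_2_expand[OF assms, of a] linear_2_expand[OF assms, of b] det_vector_2
  by (simp add: wedge_def vec_eq_iff algebra_simps)

lemma det_vector_linear_2:
  fixes L :: "real^2 \<Rightarrow> real^2"
  assumes "linear L"
  shows "det (vector [L a, L b] :: real^2^2) = det (matrix L) * det (vector [a, b] :: real^2^2)"
  unfolding linear_2_expand[OF assms, of a] linear_2_expand[OF assms, of b] det_vector_2 det_2
  by (simp add: matrix_def algebra_simps)

text \<open>The bivector \<open>wedge (D a) (D b)\<close> pairs to 1 with itself, whereas a
  vanishing determinant would make it zero.\<close>

lemma orthonormal_det_nonzero: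
  assumes D: "linear D"
    and ab: "minkowski (D a) (D a) = 1" "minkowski (D b) (D b) = 1" "minkowski (D a) (D b) = 0"
  shows "det (vector [a, b] :: real^2^2) \<noteq> 0"
proof
  assume "det (vector [a, b] :: real^2^2) = 0"
  then have "wedge (D a) (D b) = 0" using wedge_linear_2[OF D, of a b] by simp
  then have "bivector_form (wedge (D a) (D b)) (D a) (D b) = 0"
    using bivector_form_scaleR[of 0] by simp
  then show False using ab by (simp add: bivector_form_wedge)
qed

lemma orthonormal_expand:
  fixes D :: "real^2 \<Rightarrow> real^4"
  assumes D: "linear D"
    and ab: "minkowski (D a) (D a) = 1" "minkowski (D b) (D b) = 1" "minkowski (D a) (D b) = 0"
  shows "c = minkowski (D c) (D a) *\<^sub>R a + minkowski (D c) (D b) *\<^sub>R b"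
proof -
  define \<delta> where "\<delta> = det (vector [a, b] :: real^2^2)"
  have "\<delta> \<noteq> 0" unfolding \<delta>_def by (rule orthonormal_det_nonzero[OF assms])
  \<comment> \<open>The coefficients are found by Cramer's rule; orthonormality then identifies them
    as Minkowski products.\<close>
  define s where "s = det (vector [c, b] :: real^2^2) / \<delta>"
  define t where "t = det (vector [a, c] :: real^2^2) / \<delta>"
  have "\<delta> *\<^sub>R c = \<delta> *\<^sub>R (s *\<^sub>R a + t *\<^sub>R b)"
    using \<open>\<delta> \<noteq> 0\<close>
    by (simp add: s_def t_def scaleR_add_right) (simp add: \<delta>_def det_vector_2 vec_eq_iff forall_2 algebra_simps)
  then have c: "c = s *\<^sub>R a + t *\<^sub>R b" using \<open>\<delta> \<noteq> 0\<close> by simp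
  have "D c = s *\<^sub>R D a + t *\<^sub>R D b"
    unfolding c by (simp only: linear_add[OF D] linear_scale[OF D])
  then have "minkowski (D c) (D a) = s" "minkowski (D c) (D b) = t"
    using ab by (simp_all add: minkowski.add_left minkowski.scaleR_left minkowski_commute[of "D b" "D a"])
  with c show ?thesis by simp
qed

text \<open>Let \<open>q\<close> be the Gram determinant of the coordinate basis. Every orthonormal
  pair has a coordinate determinant with square \<open>1 / q\<close>, so two such determinants agree
  up to sign; and on a plane the wedge is proportional to the determinant.\<close>

lemma wedge_orthonormal_unique:
  assumes D: "linear D"
    and ab: "minkowski (D a) (D a) = 1" "minkowski (D b) (D b) = 1" "minkowski (D a) (D b) = 0"
    and cd: "minkowski (D c) (D c) = 1" "minkowski (D d) (D d) = 1" "minkowski (D c) (D d) = 0"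
    and pos: "0 < det (vector [c, d] :: real^2^2)"
  shows "wedge (D c) (D d) = sgn (det (vector [a, b] :: real^2^2)) *\<^sub>R wedge (D a) (D b)"
proof -
  let ?W = "wedge (D (axis 1 1)) (D (axis 2 1))"
  define q where "q = bivector_form ?W (D (axis 1 1)) (D (axis 2 1))"
  have gram: "minkowski (D u) (D u) * minkowski (D v) (D v) - (minkowski (D u) (D v))\<^sup>2 =
      (det (vector [u, v] :: real^2^2))\<^sup>2 * q" for u v
  proof -
    have "minkowski (D u) (D u) * minkowski (D v) (D v) - (minkowski (D u) (D v))\<^sup>2 =
        bivector_form (wedge (D u) (D v)) (D u) (D v)"
      by (simp add: bivector_form_wedge power2_eq_square minkowski_commute[of "D v" "D u"])
    also have "\<dots> = det (vector [u, v] :: real^2^2) * bivector_form ?W (D u) (D v)"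
      by (subst wedge_linear_2[OF D]) (simp add: bivector_form_scaleR)
    also have "bivector_form ?W (D u) (D v) = det (vector [u, v] :: real^2^2) * q"
      unfolding q_def linear_2_expand[OF D, of u] linear_2_expand[OF D, of v] det_vector_2
      by (simp add: bivector_form_wedge minkowski.add_right minkowski.scaleR_right algebra_simps)
    finally show ?thesis by (simp add: power2_eq_square)
  qed
  have 1: "(det (vector [a, b] :: real^2^2))\<^sup>2 * q = 1" "(det (vector [c, d] :: real^2^2))\<^sup>2 * q = 1"
    using gram[of a b] gram[of c d] ab cd by simp_all
  have "q \<noteq> 0" using 1 by auto
  then have "(det (vector [a, b] :: real^2^2))\<^sup>2 = (det (vector [c, d] :: real^2^2))\<^sup>2"
    using 1 by (metis mult_right_cancel)
  then have "det (vector [c, d] :: real^2^2) = \<bar>det (vector [a, b] :: real^2^2)\<bar>"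
    using pos by (metis abs_of_pos real_sqrt_abs)
  then show ?thesis
    unfolding wedge_linear_2[OF D, of c d] wedge_linear_2[OF D, of a b]
    by (simp add: abs_sgn mult.commute)
qed

text \<open>Chain rule: near \<open>p\<close>, \<open>x \<circ> \<phi>\<close> is
  \<open>x \<circ> \<psi>\<close> after the transition map. \<open>L\<close> is the derivative of
  that map, and its determinant is positive since the atlas is oriented.\<close>

lemma chart_change:
  assumes M: "oriented_surface M A" and im: "smooth_immersion A x"
    and U: "(U, \<phi>) \<in> A" "p \<in> U" and V: "(V, \<psi>) \<in> A" "q \<in> V" and eq: "\<psi> q = \<phi> p"
  obtains L where "linear L" "0 < det (matrix L)"
    "\<And>v. frechet_derivative (x \<circ> \<phi>) (at p) v = frechet_derivative (x \<circ> \<psi>) (at q) (L v)"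
proof -
  define W where "W = {p \<in> U. \<phi> p \<in> \<psi> ` V}"
  define \<tau> where "\<tau> = the_inv_into V \<psi> \<circ> \<phi>"
  have *: "open U" "homeomorphic_map (top_of_set U) (subtopology M (\<phi> ` U)) \<phi>" "open V"
      "openin M (\<psi> ` V)" "homeomorphic_map (top_of_set V) (subtopology M (\<psi> ` V)) \<psi>"
    using M U V unfolding oriented_surface_def by blast+
  have \<tau>: "smooth_on W \<tau>" "\<And>p. p \<in> W \<Longrightarrow> 0 < det (matrix (frechet_derivative \<tau> (at p)))"
    using M U V unfolding oriented_surface_def W_def \<tau>_def Let_def by fast+
  have "W = {p \<in> topspace (top_of_set U). \<phi> p \<in> \<psi> ` V \<inter> \<phi> ` U}"
    by (auto simp: W_def)
  moreover have "openin (subtopology M (\<phi> ` U)) (\<psi> ` V \<inter> \<phi> ` U)"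
    using *(4) by (auto simp: openin_subtopology)
  ultimately have "openin (top_of_set U) W"
    using openin_continuous_map_preimage[OF homeomorphic_imp_continuous_map[OF *(2)]] by presburger
  then have "open W" using *(1) by (simp add: openin_open_eq)
  have "p \<in> W" using U V eq by (force simp: W_def)
  have inj: "inj_on \<psi> V"
    using *(5) by (simp add: homeomorphic_map_def)
  have \<tau>p: "\<tau> p = q"
    using the_inv_into_f_f[OF inj V(2)] eq by (simp add: \<tau>_def)
  have D\<tau>: "(\<tau> has_derivative frechet_derivative \<tau> (at p)) (at p)"
    by (rule smooth_on_has_derivative[OF \<tau>(1) \<open>open W\<close> \<open>p \<in> W\<close>])
  have "smooth_on V (x \<circ> \<psi>)" using im V unfolding smooth_immersion_def by blast
  then have D\<psi>: "((x \<circ> \<psi>) has_derivative frechet_derivative (x \<circ> \<psi>) (at q)) (at q)"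
    using smooth_on_has_derivative *(3) V by blast
  have "((x \<circ> \<psi>) \<circ> \<tau> has_derivative
      frechet_derivative (x \<circ> \<psi>) (at q) \<circ> frechet_derivative \<tau> (at p)) (at p)"
    using diff_chain_at[OF D\<tau>] D\<psi> \<tau>p by simp
  then have "((x \<circ> \<phi>) has_derivative
      frechet_derivative (x \<circ> \<psi>) (at q) \<circ> frechet_derivative \<tau> (at p)) (at p)"
  proof (rule has_derivative_transform_within_open[OF _ \<open>open W\<close> \<open>p \<in> W\<close>])
    show "((x \<circ> \<psi>) \<circ> \<tau>) p' = (x \<circ> \<phi>) p'" if "p' \<in> W" for p'
      using that f_the_inv_into_f[OF inj] by (simp add: \<tau>_def W_def)
  qed
  from frechet_derivative_eqI[OF this] show ?thesis
    using has_derivative_linear[OF D\<tau>] \<tau>(2)[OF \<open>p \<in> W\<close>]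
    by (intro that[of "frechet_derivative \<tau> (at p)"]) auto
qed

text \<open>The definite description in \<open>gauss_map\<close> requires that an adapted frame
  exists and that all of them give the same bivector. An adapted frame may come from another chart;
  an orientation-preserving \<open>L\<close> carries \<open>a\<close> and \<open>b\<close> to that
  chart, where positively oriented orthonormal pairs have equal wedges. The factor
  \<open>sgn\<close> allows for \<open>a\<close>, \<open>b\<close> being negatively
  oriented.\<close>

lemma gauss_map_eq_hodge:
  assumes M: "oriented_surface M A" and im: "smooth_immersion A x" and sp: "space_like_surface A x"
    and U: "(U, \<phi>) \<in> A" "p \<in> U"
    and D_def: "D = frechet_derivative (x \<circ> \<phi>) (at p)"
    and ab: "minkowski (D a) (D a) = 1" "minkowski (D b) (D b) = 1" "minkowski (D a) (D b) = 0"
  shows "gauss_map A x (\<phi> p) =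
    hodge (sgn (det (vector [a, b] :: real^2^2)) *\<^sub>R wedge (D a) (D b))" (is "_ = ?w")
proof -
  have ch: "linear (frechet_derivative (x \<circ> \<psi>) (at q))" if "(V, \<psi>) \<in> A" "q \<in> V" for V \<psi> q
  proof -
    have "smooth_on V (x \<circ> \<psi>)" "open V"
      using M im that unfolding smooth_immersion_def oriented_surface_def by blast+
    then show ?thesis using smooth_on_has_derivative that(2) has_derivative_linear by blast
  qed
  have D: "linear D" using ch U by (simp add: D_def)
  have adapted: "wedge (e 3) (e 4) = ?w" if e: "adapted_frame A x (\<phi> p) e" for e
  proof -
    obtain V \<psi> q c d where V: "(V, \<psi>) \<in> A" "q \<in> V" "\<psi> q = \<phi> p"
      and cd: "e 1 = frechet_derivative (x \<circ> \<psi>) (at q) c" "e 2 = frechet_derivative (x \<circ> \<psi>) (at q) d"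
        "0 < det (vector [c, d] :: real^2^2)"
      and orth: "\<And>i j. i \<noteq> j \<Longrightarrow> minkowski (e i) (e j) = 0"
      and unit: "\<And>i. \<bar>minkowski (e i) (e i)\<bar> = 1"
      and pos: "0 < det (\<chi> i. e i)"
      using e unfolding adapted_frame_def Let_def by blast
    obtain L where L: "linear L" "0 < det (matrix L)"
      "\<And>v. D v = frechet_derivative (x \<circ> \<psi>) (at q) (L v)"
      unfolding D_def using chart_change[OF M im U V] by blast
    define D' where "D' = frechet_derivative (x \<circ> \<psi>) (at q)"
    have D': "linear D'" using ch V by (simp add: D'_def)
    \<comment> \<open>In an adapted frame the squares are 1 or -1; space-likeness selects 1 for the
      two tangent vectors.\<close>
    have nonneg: "0 \<le> minkowski (D' v) (D' v)" for v
      using sp V unfolding space_like_surface_def D'_def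
      by (cases "D' v = 0") (force simp: D'_def minkowski.zero_left)+
    have ee: "minkowski (e 1) (e 1) = 1" "minkowski (e 2) (e 2) = 1"
      using unit[of 1] unit[of 2] nonneg[of c] nonneg[of d] unfolding cd(1,2) D'_def by simp_all
    have "wedge (D' c) (D' d) = sgn (det (vector [L a, L b] :: real^2^2)) *\<^sub>R wedge (D' (L a)) (D' (L b))"
      using ee orth[of 1 2] ab cd(3) unfolding L(3) cd(1,2) D'_def[symmetric]
      by (intro wedge_orthonormal_unique D') simp_all
    also have "sgn (det (vector [L a, L b] :: real^2^2)) = sgn (det (vector [a, b] :: real^2^2))"
      using L(2) by (simp add: det_vector_linear_2[OF L(1)] sgn_mult)
    finally have "wedge (e 1) (e 2) = sgn (det (vector [a, b] :: real^2^2)) *\<^sub>R wedge (D a) (D b)"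
      by (simp add: cd L(3) D'_def)
    then show ?thesis
      using wedge_normal_eq_hodge[of e, OF orth unit ee pos] by simp
  qed
  have "\<exists>e. adapted_frame A x (\<phi> p) e"
  proof -
    \<comment> \<open>If \<open>a\<close>, \<open>b\<close> is negatively oriented, reversing
      \<open>b\<close> repairs this and keeps the pair orthonormal.\<close>
    define s where "s = sgn (det (vector [a, b] :: real^2^2))"
    define b' where "b' = s *\<^sub>R b"
    have "det (vector [a, b] :: real^2^2) \<noteq> 0" by (rule orthonormal_det_nonzero[OF D ab])
    then have s: "s * s = 1" and pos: "det (vector [a, b'] :: real^2^2) > 0"
      by (auto simp: s_def b'_def det_vector_2 sgn_real_def algebra_simps split: if_splits)
    have Db': "D b' = s *\<^sub>R D b" using D by (simp add: b'_def linear_scale)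
    obtain e :: "4 \<Rightarrow> real^4" where e: "e 1 = D a" "e 2 = D b'"
        and orth: "\<And>i j. i \<noteq> j \<Longrightarrow> minkowski (e i) (e j) = 0"
        and "\<And>i. \<bar>minkowski (e i) (e i)\<bar> = 1" "0 < det (\<chi> i. e i)"
      using ex_normal_frame[of "D a" "D b'"] ab s
      by (auto simp: Db' minkowski.scaleR_left minkowski.scaleR_right)
    moreover have "minkowski (e i) (D c) = 0" if "i \<noteq> 1" "i \<noteq> 2" for i c
    proof -
      have "D c = minkowski (D c) (D a) *\<^sub>R e 1 + minkowski (D c) (D b') *\<^sub>R e 2"
        using arg_cong[OF orthonormal_expand[OF D, of a b' c], of D] ab s
        unfolding e by (simp add: Db' minkowski.scaleR_left minkowski.scaleR_right
          linear_add[OF D] linear_scale[OF D])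
      then have "minkowski (e i) (D c) =
          minkowski (e i) (minkowski (D c) (D a) *\<^sub>R e 1 + minkowski (D c) (D b') *\<^sub>R e 2)"
        by (rule arg_cong)
      then show ?thesis
        using that by (simp add: orth minkowski.add_right minkowski.scaleR_right)
    qed
    ultimately have orient: "\<exists>a b. e 1 = D a \<and> e 2 = D b \<and> 0 < det (vector [a, b] :: real^2^2)"
      and normal: "\<forall>c. minkowski (e 3) (D c) = 0 \<and> minkowski (e 4) (D c) = 0"
      and frame: "\<forall>i j. i \<noteq> j \<longrightarrow> minkowski (e i) (e j) = 0"
        "\<forall>i. \<bar>minkowski (e i) (e i)\<bar> = 1" "0 < det (\<chi> i. e i)"
      using pos by auto
    have "\<exists>(V, \<psi>) \<in> A. \<exists>q \<in> V. \<psi> q = \<phi> p \<and>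
        (let D = frechet_derivative (x \<circ> \<psi>) (at q) in
          (\<exists>a b. e 1 = D a \<and> e 2 = D b \<and> 0 < det (vector [a, b] :: real^2^2)) \<and>
          (\<forall>c. minkowski (e 3) (D c) = 0 \<and> minkowski (e 4) (D c) = 0))"
      by (rule bexI[OF _ U(1)], simp only: prod.case, rule bexI[OF _ U(2)])
        (use orient normal in \<open>simp add: Let_def flip: D_def\<close>)
    with frame have "adapted_frame A x (\<phi> p) e"
      unfolding adapted_frame_def by blast
    then show ?thesis by blast
  qed
  with adapted show ?thesis
    unfolding gauss_map_def by (intro the_equality) (auto 4 4)
qed

subsection \<open>Derivatives along vector fields\<close>

lemma along_cong:
  assumes "open U" "p \<in> U" "smooth_on U f" "\<And>q. q \<in> U \<Longrightarrow> f q = g q"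
  shows "along X f p = along X g p"
  using frechet_derivative_transform_within_open[OF differentiableI[OF
    smooth_on_has_derivative[OF assms(3,1,2)]] assms(1,2,4)]
  by (simp add: along_def)

lemma (in bounded_bilinear) along:
  assumes "open U" "p \<in> U" "smooth_on U f" "smooth_on U g"
  shows "along X (\<lambda>q. prod (f q) (g q)) p = prod (f p) (along X g p) + prod (along X f p) (g p)"
  unfolding along_def
  by (rule frechet_derivative_eqI)
    (rule FDERIV[OF smooth_on_has_derivative[OF assms(3,1,2)] smooth_on_has_derivative[OF assms(4,1,2)]])

lemma along_const [simp]: "along X (\<lambda>q. c) p = 0"
  by (simp add: along_def)

lemma along_add:
  assumes "open U" "p \<in> U" "smooth_on U f" "smooth_on U g"
  shows "along X (\<lambda>q. f q + g q) p = along X f p + along X g p"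
  unfolding along_def
  by (rule frechet_derivative_eqI)
    (rule has_derivative_add[OF smooth_on_has_derivative[OF assms(3,1,2)]
      smooth_on_has_derivative[OF assms(4,1,2)]])

lemma along_diff:
  assumes "open U" "p \<in> U" "smooth_on U f" "smooth_on U g"
  shows "along X (\<lambda>q. f q - g q) p = along X f p - along X g p"
  unfolding along_def
  by (rule frechet_derivative_eqI)
    (rule has_derivative_diff[OF smooth_on_has_derivative[OF assms(3,1,2)]
      smooth_on_has_derivative[OF assms(4,1,2)]])

lemma along_sum:
  assumes "open U" "p \<in> U" "\<And>i. i \<in> I \<Longrightarrow> smooth_on U (f i)"
  shows "along X (\<lambda>q. \<Sum>i\<in>I. f i q) p = (\<Sum>i\<in>I. along X (f i) p)"
  unfolding along_def
  by (rule frechet_derivative_eqI)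
    (rule has_derivative_sum[OF smooth_on_has_derivative[OF assms(3,1,2)]])

lemma along_linear:
  assumes "open U" "p \<in> U" "smooth_on U f" "bounded_linear L"
  shows "along X (\<lambda>q. L (f q)) p = L (along X f p)"
  unfolding along_def
  by (rule frechet_derivative_eqI)
    (rule bounded_linear.has_derivative[OF assms(4) smooth_on_has_derivative[OF assms(3,1,2)]])

lemma smooth_on_linear:
  assumes "open U" "smooth_on U f" "bounded_linear L"
  shows "smooth_on U (\<lambda>q. L (f q))"
proof -
  have "Ck_on k U (\<lambda>q. L (f q))" if "smooth_on U f" for k and f :: "'a \<Rightarrow> 'b"
    using that
  proof (induction k arbitrary: f)
    case 0
    then show ?case
      using bounded_linear.continuous_on[OF assms(3)] smooth_on_continuous_on by fastforce
  next
    case (Suc k)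
    note D = bounded_linear.has_derivative[OF assms(3) smooth_on_has_derivative[OF Suc.prems assms(1)]]
    have "Ck_on k U (\<lambda>q. L (frechet_derivative f (at q) v))" for v
      by (rule Suc.IH) (rule smooth_on_frechet_derivative[OF Suc.prems])
    then have "Ck_on k U (\<lambda>q. frechet_derivative (\<lambda>q. L (f q)) (at q) v)" for v
      by (rule Ck_on_cong[OF assms(1), rotated]) (rule frechet_derivative_eqI[OF D, symmetric])
    moreover have "(\<lambda>q. L (f q)) differentiable_on U"
      unfolding differentiable_on_def
    proof
      fix p assume "p \<in> U"
      then show "(\<lambda>q. L (f q)) differentiable (at p within U)"
        by (rule differentiable_at_withinI[OF differentiableI[OF D]])
    qed
    ultimately show ?case by simp
  qed
  with assms(2) show ?thesis by (simp add: smooth_on_def)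
qed

text \<open>Leibniz rule after expanding \<open>Y\<close> in the standard basis: one part
  differentiates the coefficients of \<open>Y\<close>, the other is the Hessian of \<open>f\<close>
  at \<open>Y p\<close> and \<open>X p\<close>.\<close>

lemma along_along:
  fixes f :: "real^2 \<Rightarrow> 'b::real_normed_vector"
  assumes "open U" "p \<in> U" "smooth_on U f" "smooth_on U Y"
  shows "along X (along Y f) p = frechet_derivative f (at p) (along X Y p) +
    (\<Sum>b\<in>Basis. \<Sum>c\<in>Basis. (Y p \<bullet> b) *\<^sub>R (X p \<bullet> c) *\<^sub>R
      frechet_derivative (\<lambda>q. frechet_derivative f (at q) b) (at p) c)"
proof -
  note D = smooth_on_has_derivative[OF _ assms(1)]
  have second: "along X (\<lambda>q. frechet_derivative f (at q) b) p =
      (\<Sum>c\<in>Basis. (X p \<bullet> c) *\<^sub>R frechet_derivative (\<lambda>q. frechet_derivative f (at q) b) (at p) c)" for b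
    unfolding along_def
    by (rule frechet_derivative_Basis[OF D[OF smooth_on_frechet_derivative[OF assms(3)] assms(2)]])
  have smooth: "smooth_on U (\<lambda>q. (Y q \<bullet> b) *\<^sub>R frechet_derivative f (at q) b)" for b
    by (intro smooth_on_scaleR smooth_on_inner smooth_on_const smooth_on_frechet_derivative assms)
  have "along X (along Y f) p =
      along X (\<lambda>q. \<Sum>b\<in>Basis. (Y q \<bullet> b) *\<^sub>R frechet_derivative f (at q) b) p"
  proof (rule along_cong[OF assms(1,2) smooth_on_along[OF assms(1,4,3)]])
    show "along Y f q = (\<Sum>b\<in>Basis. (Y q \<bullet> b) *\<^sub>R frechet_derivative f (at q) b)" if "q \<in> U" for q
      unfolding along_def by (rule frechet_derivative_Basis[OF D[OF assms(3) that]])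
  qed
  also have "\<dots> = (\<Sum>b\<in>Basis. along X (\<lambda>q. (Y q \<bullet> b) *\<^sub>R frechet_derivative f (at q) b) p)"
    by (rule along_sum[OF assms(1,2) smooth])
  also have "\<dots> = (\<Sum>b\<in>Basis. (Y p \<bullet> b) *\<^sub>R along X (\<lambda>q. frechet_derivative f (at q) b) p
      + (along X Y p \<bullet> b) *\<^sub>R frechet_derivative f (at p) b)"
  proof (rule sum.cong[OF refl])
    fix b :: "real^2"
    have "along X (\<lambda>q. Y q \<bullet> b) p = along X Y p \<bullet> b"
      by (rule along_linear[OF assms(1,2,4) bounded_linear_inner_left])
    then show "along X (\<lambda>q. (Y q \<bullet> b) *\<^sub>R frechet_derivative f (at q) b) p =
        (Y p \<bullet> b) *\<^sub>R along X (\<lambda>q. frechet_derivative f (at q) b) p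
          + (along X Y p \<bullet> b) *\<^sub>R frechet_derivative f (at p) b"
      using bounded_bilinear.along[OF bounded_bilinear_scaleR assms(1,2), where X = X,
        OF smooth_on_inner[OF assms(1,4) smooth_on_const] smooth_on_frechet_derivative[OF assms(3)]]
      by simp
  qed
  also have "\<dots> = (\<Sum>b\<in>Basis. (along X Y p \<bullet> b) *\<^sub>R frechet_derivative f (at p) b) +
      (\<Sum>b\<in>Basis. (Y p \<bullet> b) *\<^sub>R along X (\<lambda>q. frechet_derivative f (at q) b) p)"
    by (simp add: sum.distrib add.commute)
  also have "(\<Sum>b\<in>Basis. (along X Y p \<bullet> b) *\<^sub>R frechet_derivative f (at p) b) =
      frechet_derivative f (at p) (along X Y p)"
    by (rule frechet_derivative_Basis[OF D[OF assms(3,2)], symmetric])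
  finally show ?thesis by (simp only: second scaleR_sum_right)
qed

text \<open>The Hessian parts cancel by symmetry of second derivatives; what remains is the
  derivative along the Lie bracket of \<open>X\<close> and \<open>Y\<close>.\<close>

lemma along_commute:
  fixes f :: "real^2 \<Rightarrow> 'b::euclidean_space"
  assumes "open U" "p \<in> U" "smooth_on U f" "smooth_on U X" "smooth_on U Y"
  shows "along X (along Y f) p - along Y (along X f) p =
    frechet_derivative f (at p) (along X Y p - along Y X p)"
proof -
  have "(\<Sum>b\<in>Basis. \<Sum>c\<in>Basis. (Y p \<bullet> b) *\<^sub>R (X p \<bullet> c) *\<^sub>R
      frechet_derivative (\<lambda>q. frechet_derivative f (at q) b) (at p) c) =
    (\<Sum>b\<in>Basis. \<Sum>c\<in>Basis. (X p \<bullet> b) *\<^sub>R (Y p \<bullet> c) *\<^sub>R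
      frechet_derivative (\<lambda>q. frechet_derivative f (at q) b) (at p) c)"
    by (subst sum.swap, intro sum.cong refl)
      (simp add: frechet_derivative_commute[OF assms(1,3,2)] mult.commute)
  then show ?thesis
    unfolding along_along[OF assms(1-3,5), of X] along_along[OF assms(1-3,4), of Y]
    using linear_diff[OF has_derivative_linear[OF smooth_on_has_derivative[OF assms(3,1,2)]]]
    by simp
qed

subsection \<open>Moving frames\<close>

text \<open>The local setting, with one parametrization and one orthonormal frame and without any
  atlas. The coordinate fields \<open>E i\<close> correspond to the tangent vectors
  \<open>e i\<close> in Minkowski space.\<close>

locale framed_surface =
  fixes r :: "real^2 \<Rightarrow> real^4" and V :: "(real^2) set" and E :: "2 \<Rightarrow> real^2 \<Rightarrow> real^2"
  assumes open_V: "open V"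
    and smooth_r: "smooth_on V r"
    and smooth_E: "smooth_on V (E i)"
    and orthonormal: "p \<in> V \<Longrightarrow>
      minkowski (along (E i) r p) (along (E j) r p) = (if i = j then 1 else 0)"
begin

abbreviation e :: "2 \<Rightarrow> real^2 \<Rightarrow> real^4" where "e i \<equiv> along (E i) r"

definition \<omega> :: "2 \<Rightarrow> real^2 \<Rightarrow> real" where
  "\<omega> i p = minkowski (along (E i) (e 1) p) (e 2 p)"

text \<open>The components of the second fundamental form, written out with the connection form
  \<open>\<omega>\<close> to avoid the definite description in \<open>levi_civita\<close>. The mixed
  one is read off from the derivative of \<open>e 2\<close> along \<open>E 1\<close>; that the other
  order gives the same is part of \<open>frame_equations\<close>.\<close>

definition h11 :: "real^2 \<Rightarrow> real^4" where "h11 p = along (E 1) (e 1) p - \<omega> 1 p *\<^sub>R e 2 p"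
definition h12 :: "real^2 \<Rightarrow> real^4" where "h12 p = along (E 1) (e 2) p + \<omega> 1 p *\<^sub>R e 1 p"
definition h22 :: "real^2 \<Rightarrow> real^4" where "h22 p = along (E 2) (e 2) p + \<omega> 2 p *\<^sub>R e 1 p"

lemmas smooth_rules =
  smooth_r smooth_E smooth_on_const smooth_on_along[OF open_V smooth_E]
  smooth_on_add[OF open_V] smooth_on_diff[OF open_V] smooth_on_scaleR[OF open_V]
  smooth_on_mult[OF open_V] minkowski.smooth_on[OF open_V] wedge.smooth_on[OF open_V]

lemma smooth_e: "smooth_on V (e i)"
  by (intro smooth_rules)

lemma smooth_\<omega>: "smooth_on V (\<omega> i)"
  unfolding \<omega>_def[abs_def] by (intro smooth_rules)

lemma smooth_h: "smooth_on V h11" "smooth_on V h12" "smooth_on V h22"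
  unfolding h11_def[abs_def] h12_def[abs_def] h22_def[abs_def] by (intro smooth_rules smooth_\<omega>)+

lemmas smooth_intros = smooth_e smooth_\<omega> smooth_h smooth_rules

lemma orthonormal_e: "p \<in> V \<Longrightarrow> minkowski (e 1 p) (e 1 p) = 1" "p \<in> V \<Longrightarrow> minkowski (e 2 p) (e 2 p) = 1"
  "p \<in> V \<Longrightarrow> minkowski (e 1 p) (e 2 p) = 0" "p \<in> V \<Longrightarrow> minkowski (e 2 p) (e 1 p) = 0"
  using orthonormal[of p 1 1] orthonormal[of p 2 2] orthonormal[of p 1 2] orthonormal[of p 2 1]
  by simp_all

section \<open>The Levi-Civita connection and the structure equations of the frame\<close>

lemma minkowski_along_const:
  assumes "p \<in> V" "smooth_on V f" "smooth_on V g" "\<And>q. q \<in> V \<Longrightarrow> minkowski (f q) (g q) = c"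
  shows "minkowski (along X f p) (g p) = - minkowski (f p) (along X g p)"
proof -
  have "along X (\<lambda>q. minkowski (f q) (g q)) p = along X (\<lambda>q. c) p"
    by (rule along_cong[OF open_V assms(1)]) (use assms in \<open>auto intro: minkowski.smooth_on[OF open_V]\<close>)
  then show ?thesis
    using minkowski.along[OF open_V assms(1-3), of X] by simp
qed

lemma linear_dr: "p \<in> V \<Longrightarrow> linear (frechet_derivative r (at p))"
  using smooth_on_has_derivative[OF smooth_r open_V] has_derivative_linear by blast

lemma tangent_expand:
  assumes "p \<in> V"
  shows "v = minkowski (frechet_derivative r (at p) v) (e 1 p) *\<^sub>R E 1 p
    + minkowski (frechet_derivative r (at p) v) (e 2 p) *\<^sub>R E 2 p"
  using orthonormal_expand[OF linear_dr[OF assms], of "E 1 p" "E 2 p" v] orthonormal_e[OF assms]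
  by (simp add: along_def)

lemma frechet_derivative_frame:
  assumes "p \<in> V" "smooth_on V f"
  shows "frechet_derivative f (at p) (s *\<^sub>R E i p + t *\<^sub>R E j p) =
    s *\<^sub>R along (E i) f p + t *\<^sub>R along (E j) f p"
proof -
  have "linear (frechet_derivative f (at p))"
    using smooth_on_has_derivative[OF assms(2) open_V assms(1)] by (rule has_derivative_linear)
  then show ?thesis by (simp add: along_def linear_add linear_scale)
qed

text \<open>Orthogonal projection onto the frame satisfies the defining condition, and a tangent
  vector is determined by its products with the frame.\<close>

lemma levi_civita_eq:
  assumes p: "p \<in> V"
  shows "levi_civita r X Y p = minkowski (along X (along Y r) p) (e 1 p) *\<^sub>R E 1 p
    + minkowski (along X (along Y r) p) (e 2 p) *\<^sub>R E 2 p" (is "_ = ?a")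
  unfolding levi_civita_def
proof (rule the_equality)
  let ?D = "frechet_derivative r (at p)" and ?w = "along X (along Y r) p"
  have Da: "?D ?a = minkowski ?w (e 1 p) *\<^sub>R e 1 p + minkowski ?w (e 2 p) *\<^sub>R e 2 p"
    by (rule frechet_derivative_frame[OF p smooth_r])
  have "minkowski (?w - ?D ?a) (?D b) = 0" for b
  proof -
    have "?D b = minkowski (?D b) (e 1 p) *\<^sub>R e 1 p + minkowski (?D b) (e 2 p) *\<^sub>R e 2 p"
      using arg_cong[OF tangent_expand[OF p, of b], of ?D]
      unfolding frechet_derivative_frame[OF p smooth_r] .
    then obtain s t where b: "?D b = s *\<^sub>R e 1 p + t *\<^sub>R e 2 p" by blast
    show ?thesis
      unfolding Da b by (simp add: orthonormal_e[OF p] minkowski.add_left minkowski.add_right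
        minkowski.diff_left minkowski.scaleR_left minkowski.scaleR_right)
  qed
  then show "\<forall>b. minkowski (?w - ?D ?a) (?D b) = 0" by blast
  fix a assume "\<forall>b. minkowski (?w - ?D a) (?D b) = 0"
  then have "minkowski (?w - ?D a) (e i p) = 0" for i by (simp add: along_def)
  then have "minkowski (?D a) (e i p) = minkowski ?w (e i p)" for i
    by (simp add: minkowski.diff_left)
  then show "a = ?a" using tangent_expand[OF p, of a] by simp
qed

lemma connection:
  assumes p: "p \<in> V"
  shows "minkowski (along X (e 1) p) (e 1 p) = 0" "minkowski (along X (e 2) p) (e 2 p) = 0"
    "minkowski (along (E i) (e 1) p) (e 2 p) = \<omega> i p"
    "minkowski (along (E i) (e 2) p) (e 1 p) = - \<omega> i p"
proof -
  show "minkowski (along X (e 1) p) (e 1 p) = 0" "minkowski (along X (e 2) p) (e 2 p) = 0"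
    using minkowski_along_const[OF p smooth_e smooth_e orthonormal_e(1), of X]
      minkowski_along_const[OF p smooth_e smooth_e orthonormal_e(2), of X]
    by (simp_all add: minkowski_commute)
  show 1: "minkowski (along (E i) (e 1) p) (e 2 p) = \<omega> i p" by (simp add: \<omega>_def)
  show "minkowski (along (E i) (e 2) p) (e 1 p) = - \<omega> i p"
    using minkowski_along_const[OF p smooth_e smooth_e orthonormal_e(4), of "E i"] 1
    by (simp add: minkowski_commute)
qed

text \<open>The connection is torsion-free: the derivative of \<open>r\<close> maps the bracket to a
  difference of ambient derivatives, whose tangential components are values of
  \<open>\<omega>\<close>.\<close>

lemma bracket:
  assumes p: "p \<in> V"
  shows "along (E 1) (E 2) p - along (E 2) (E 1) p = (- \<omega> 1 p) *\<^sub>R E 1 p + (- \<omega> 2 p) *\<^sub>R E 2 p"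
proof -
  let ?v = "along (E 1) (E 2) p - along (E 2) (E 1) p"
  have "frechet_derivative r (at p) ?v = along (E 1) (e 2) p - along (E 2) (e 1) p"
    by (rule along_commute[OF open_V p smooth_r smooth_E smooth_E, symmetric])
  then have "minkowski (frechet_derivative r (at p) ?v) (e 1 p) = - \<omega> 1 p"
    "minkowski (frechet_derivative r (at p) ?v) (e 2 p) = - \<omega> 2 p"
    by (simp_all add: minkowski.diff_left connection[OF p])
  then show ?thesis using tangent_expand[OF p, of ?v] by simp
qed

lemma frame_commute:
  fixes f :: "real^2 \<Rightarrow> 'b::euclidean_space"
  assumes p: "p \<in> V" and f: "smooth_on V f"
  shows "along (E 1) (along (E 2) f) p - along (E 2) (along (E 1) f) p =
    - (\<omega> 1 p *\<^sub>R along (E 1) f p) - \<omega> 2 p *\<^sub>R along (E 2) f p"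
  unfolding along_commute[OF open_V p f smooth_E smooth_E] bracket[OF p]
    frechet_derivative_frame[OF p f] by simp

text \<open>Only the third equation is more than a definition. It is the symmetry of the second
  fundamental form, obtained from the commutator relation for \<open>r\<close> itself.\<close>

lemma frame_equations:
  assumes p: "p \<in> V"
  shows "along (E 1) (e 1) p = h11 p + \<omega> 1 p *\<^sub>R e 2 p"
    and "along (E 1) (e 2) p = h12 p - \<omega> 1 p *\<^sub>R e 1 p"
    and "along (E 2) (e 1) p = h12 p + \<omega> 2 p *\<^sub>R e 2 p"
    and "along (E 2) (e 2) p = h22 p - \<omega> 2 p *\<^sub>R e 1 p"
  using frame_commute[OF p smooth_r] by (simp_all add: h11_def h12_def h22_def algebra_simps)

lemma h_normal:
  assumes p: "p \<in> V"
  shows "minkowski (h11 p) (e 1 p) = 0" "minkowski (h11 p) (e 2 p) = 0"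
    "minkowski (h12 p) (e 1 p) = 0" "minkowski (h12 p) (e 2 p) = 0"
    "minkowski (h22 p) (e 1 p) = 0" "minkowski (h22 p) (e 2 p) = 0"
  by (simp_all add: h11_def h12_def h22_def minkowski.diff_left minkowski.add_left
    minkowski.scaleR_left connection[OF p] orthonormal_e[OF p])

lemma mean_curvature_vector_eq:
  assumes p: "p \<in> V"
  shows "mean_curvature_vector r E p = (1/2) *\<^sub>R (h11 p + h22 p)"
proof -
  have "along (levi_civita r (E 1) (E 1)) r p = \<omega> 1 p *\<^sub>R e 2 p"
    "along (levi_civita r (E 2) (E 2)) r p = - (\<omega> 2 p *\<^sub>R e 1 p)"
    using frechet_derivative_frame[OF p smooth_r, of 0 1 "\<omega> 1 p" 2]
      frechet_derivative_frame[OF p smooth_r, of "- \<omega> 2 p" 1 0 2]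
    by (simp_all add: along_def[of "levi_civita _ _ _"] levi_civita_eq[OF p] connection[OF p])
  then show ?thesis
    by (simp add: mean_curvature_vector_def second_fundamental_form_def h11_def h22_def)
qed

section \<open>The Laplacian of the area bivector\<close>

lemma frame_laplacian_eq:
  assumes p: "p \<in> V" and f: "smooth_on V f"
  shows "frame_laplacian r E f p = \<omega> 1 p *\<^sub>R along (E 2) f p - \<omega> 2 p *\<^sub>R along (E 1) f p
    - along (E 1) (along (E 1) f) p - along (E 2) (along (E 2) f) p"
proof -
  have "along (levi_civita r (E 1) (E 1)) f p = \<omega> 1 p *\<^sub>R along (E 2) f p"
    "along (levi_civita r (E 2) (E 2)) f p = - (\<omega> 2 p *\<^sub>R along (E 1) f p)"
    using frechet_derivative_frame[OF p f, of 0 1 "\<omega> 1 p" 2]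
      frechet_derivative_frame[OF p f, of "- \<omega> 2 p" 1 0 2]
    by (simp_all add: along_def[of "levi_civita _ _ _"] levi_civita_eq[OF p] connection[OF p])
  then show ?thesis by (simp add: frame_laplacian_def sum_2)
qed

abbreviation area :: "real^2 \<Rightarrow> real^4^4" where "area \<equiv> \<lambda>p. wedge (e 1 p) (e 2 p)"

text \<open>The terms with \<open>\<omega>\<close> rotate \<open>e 1\<close> and \<open>e 2\<close>
  within the tangent plane and drop out because \<open>wedge v v = 0\<close>.\<close>

lemma along_area:
  assumes p: "p \<in> V"
  shows "along (E 1) area p = wedge (h11 p) (e 2 p) + wedge (e 1 p) (h12 p)"
    "along (E 2) area p = wedge (h12 p) (e 2 p) + wedge (e 1 p) (h22 p)"
  by (simp_all add: wedge.along[OF open_V p smooth_e smooth_e] frame_equations[OF p]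
    wedge.add_left wedge.diff_right wedge.scaleR_left wedge.scaleR_right)

lemma laplacian_area:
  assumes p: "p \<in> V"
  shows "frame_laplacian r E area p =
    \<omega> 1 p *\<^sub>R (wedge (h12 p) (e 2 p) + wedge (e 1 p) (h22 p)) -
    \<omega> 2 p *\<^sub>R (wedge (h11 p) (e 2 p) + wedge (e 1 p) (h12 p)) -
    (wedge (h11 p) (along (E 1) (e 2) p) + wedge (along (E 1) h11 p) (e 2 p) +
     (wedge (e 1 p) (along (E 1) h12 p) + wedge (along (E 1) (e 1) p) (h12 p))) -
    (wedge (h12 p) (along (E 2) (e 2) p) + wedge (along (E 2) h12 p) (e 2 p) +
     (wedge (e 1 p) (along (E 2) h22 p) + wedge (along (E 2) (e 1) p) (h22 p)))"
proof -
  have area: "smooth_on V area" by (intro smooth_intros)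
  have "along (E 1) (along (E 1) area) p =
      along (E 1) (\<lambda>p. wedge (h11 p) (e 2 p) + wedge (e 1 p) (h12 p)) p"
    "along (E 2) (along (E 2) area) p =
      along (E 2) (\<lambda>p. wedge (h12 p) (e 2 p) + wedge (e 1 p) (h22 p)) p"
    by (rule along_cong[OF open_V p smooth_on_along[OF open_V smooth_E area]],
      simp add: along_area)+
  moreover have "along (E i) (\<lambda>p. wedge (f p) (e 2 p) + wedge (e 1 p) (g p)) p =
      wedge (f p) (along (E i) (e 2) p) + wedge (along (E i) f p) (e 2 p) +
      (wedge (e 1 p) (along (E i) g p) + wedge (along (E i) (e 1) p) (g p))"
    if "smooth_on V f" "smooth_on V g" for f g i
    using along_add[OF open_V p wedge.smooth_on[OF open_V that(1) smooth_e]
        wedge.smooth_on[OF open_V smooth_e that(2)]]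
      wedge.along[OF open_V p that(1) smooth_e] wedge.along[OF open_V p smooth_e that(2)]
    by simp
  ultimately show ?thesis
    unfolding frame_laplacian_eq[OF p area] along_area[OF p] by (simp add: smooth_h)
qed

section \<open>The Gauss, Codazzi and eigenvalue equations\<close>

lemma h_normal':
  assumes p: "p \<in> V"
  shows "minkowski (e 1 p) (h11 p) = 0" "minkowski (e 2 p) (h11 p) = 0"
    "minkowski (e 1 p) (h12 p) = 0" "minkowski (e 2 p) (h12 p) = 0"
    "minkowski (e 1 p) (h22 p) = 0" "minkowski (e 2 p) (h22 p) = 0"
  using h_normal[OF p] by (simp_all add: minkowski_commute)

lemmas minkowski_bilinear = minkowski.add_left minkowski.add_right minkowski.diff_left
  minkowski.diff_right minkowski.scaleR_left minkowski.scaleR_right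

lemma along_h_tangent:
  assumes p: "p \<in> V"
  shows "minkowski (along X h11 p) (e i p) = - minkowski (h11 p) (along X (e i) p)"
    "minkowski (along X h12 p) (e i p) = - minkowski (h12 p) (along X (e i) p)"
    "minkowski (along X h22 p) (e i p) = - minkowski (h22 p) (along X (e i) p)"
proof -
  have "minkowski (h11 q) (e i q) = 0 \<and> minkowski (h12 q) (e i q) = 0 \<and> minkowski (h22 q) (e i q) = 0"
    if "q \<in> V" for q
    using exhaust_2[of i] h_normal[OF that] by auto
  then show "minkowski (along X h11 p) (e i p) = - minkowski (h11 p) (along X (e i) p)"
    "minkowski (along X h12 p) (e i p) = - minkowski (h12 p) (along X (e i) p)"
    "minkowski (along X h22 p) (e i p) = - minkowski (h22 p) (along X (e i) p)"
    by (auto intro!: minkowski_along_const[OF p] smooth_e smooth_h)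
qed

text \<open>The commutator relation applied to \<open>e\<^sub>1\<close> and \<open>e\<^sub>2\<close>: its normal parts are the Codazzi
  equations, its tangential part is the Gauss equation.\<close>

lemma integrability:
  assumes p: "p \<in> V"
  shows "along (E 1) h12 p + \<omega> 2 p *\<^sub>R (h12 p - \<omega> 1 p *\<^sub>R e 1 p) + along (E 1) (\<omega> 2) p *\<^sub>R e 2 p
      - (along (E 2) h11 p + \<omega> 1 p *\<^sub>R (h22 p - \<omega> 2 p *\<^sub>R e 1 p) + along (E 2) (\<omega> 1) p *\<^sub>R e 2 p)
    = - (\<omega> 1 p *\<^sub>R (h11 p + \<omega> 1 p *\<^sub>R e 2 p)) - \<omega> 2 p *\<^sub>R (h12 p + \<omega> 2 p *\<^sub>R e 2 p)" (is ?first)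
    and "along (E 1) h22 p - (\<omega> 2 p *\<^sub>R (h11 p + \<omega> 1 p *\<^sub>R e 2 p) + along (E 1) (\<omega> 2) p *\<^sub>R e 1 p)
      - (along (E 2) h12 p - (\<omega> 1 p *\<^sub>R (h12 p + \<omega> 2 p *\<^sub>R e 2 p) + along (E 2) (\<omega> 1) p *\<^sub>R e 1 p))
    = - (\<omega> 1 p *\<^sub>R (h12 p - \<omega> 1 p *\<^sub>R e 1 p)) - \<omega> 2 p *\<^sub>R (h22 p - \<omega> 2 p *\<^sub>R e 1 p)" (is ?second)
proof -
  have scale: "along (E i) (\<lambda>q. \<omega> j q *\<^sub>R e k q) p =
      \<omega> j p *\<^sub>R along (E i) (e k) p + along (E i) (\<omega> j) p *\<^sub>R e k p" for i j k
    by (rule bounded_bilinear.along[OF bounded_bilinear_scaleR open_V p smooth_\<omega> smooth_e])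
  have sc: "smooth_on V (\<lambda>q. \<omega> j q *\<^sub>R e k q)" for j k
    by (intro smooth_intros)
  have cong: "along X (along (E i) (e j)) p = along X f p"
    if "\<And>q. q \<in> V \<Longrightarrow> along (E i) (e j) q = f q" for X i j f
    by (rule along_cong[OF open_V p _ that]) (intro smooth_intros)
  have "along (E 1) (along (E 2) (e 1)) p = along (E 1) (\<lambda>q. h12 q + \<omega> 2 q *\<^sub>R e 2 q) p"
    "along (E 2) (along (E 1) (e 1)) p = along (E 2) (\<lambda>q. h11 q + \<omega> 1 q *\<^sub>R e 2 q) p"
    "along (E 1) (along (E 2) (e 2)) p = along (E 1) (\<lambda>q. h22 q - \<omega> 2 q *\<^sub>R e 1 q) p"
    "along (E 2) (along (E 1) (e 2)) p = along (E 2) (\<lambda>q. h12 q - \<omega> 1 q *\<^sub>R e 1 q) p"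
    by (rule cong, rule frame_equations, assumption)+
  then have dd: "along (E 1) (along (E 2) (e 1)) p = along (E 1) h12 p
      + (\<omega> 2 p *\<^sub>R along (E 1) (e 2) p + along (E 1) (\<omega> 2) p *\<^sub>R e 2 p)"
    "along (E 2) (along (E 1) (e 1)) p = along (E 2) h11 p
      + (\<omega> 1 p *\<^sub>R along (E 2) (e 2) p + along (E 2) (\<omega> 1) p *\<^sub>R e 2 p)"
    "along (E 1) (along (E 2) (e 2)) p = along (E 1) h22 p
      - (\<omega> 2 p *\<^sub>R along (E 1) (e 1) p + along (E 1) (\<omega> 2) p *\<^sub>R e 1 p)"
    "along (E 2) (along (E 1) (e 2)) p = along (E 2) h12 p
      - (\<omega> 1 p *\<^sub>R along (E 2) (e 1) p + along (E 2) (\<omega> 1) p *\<^sub>R e 1 p)"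
    by (simp_all only: along_add[OF open_V p smooth_h(1) sc] along_add[OF open_V p smooth_h(2) sc]
      along_diff[OF open_V p smooth_h(2) sc] along_diff[OF open_V p smooth_h(3) sc] scale)
  show ?first ?second
    using frame_commute[OF p smooth_e, of 1] frame_commute[OF p smooth_e, of 2]
    unfolding dd unfolding frame_equations[OF p] by (simp_all only: add.assoc)
qed

text \<open>The component of the first relation of \<open>integrability\<close> along
  \<open>e 2\<close>. The left side is d\<omega> evaluated on the frame, the right side is minus the
  Gaussian curvature.\<close>

lemma gauss_equation:
  assumes p: "p \<in> V"
  shows "along (E 1) (\<omega> 2) p - along (E 2) (\<omega> 1) p + (\<omega> 1 p)\<^sup>2 + (\<omega> 2 p)\<^sup>2 =
    minkowski (h12 p) (h12 p) - minkowski (h11 p) (h22 p)"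
  using arg_cong[OF integrability(1)[OF p], of "\<lambda>v. minkowski v (e 2 p)"]
  by (simp add: minkowski_bilinear minkowski.minus_left along_h_tangent[OF p] frame_equations[OF p]
    h_normal[OF p] orthonormal_e[OF p] power2_eq_square)

lemma codazzi_equations:
  assumes p: "p \<in> V" and n: "minkowski (e 1 p) n = 0" "minkowski (e 2 p) n = 0"
  shows "minkowski (along (E 1) h12 p) n - minkowski (along (E 2) h11 p) n =
      \<omega> 1 p * (minkowski (h22 p) n - minkowski (h11 p) n) - 2 * \<omega> 2 p * minkowski (h12 p) n"
    and "minkowski (along (E 1) h22 p) n - minkowski (along (E 2) h12 p) n =
      \<omega> 2 p * (minkowski (h11 p) n - minkowski (h22 p) n) - 2 * \<omega> 1 p * minkowski (h12 p) n"
  using arg_cong[OF integrability(1)[OF p], of "\<lambda>v. minkowski v n"]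
    arg_cong[OF integrability(2)[OF p], of "\<lambda>v. minkowski v n"]
  by (simp_all add: minkowski_bilinear minkowski.minus_left n algebra_simps)

text \<open>The eigenvalue equation is paired with the wedges of \<open>e 1\<close> and
  \<open>e 2\<close>, of \<open>e 1\<close> and \<open>n\<close>, of \<open>e 2\<close> and
  \<open>n\<close>, and of \<open>n\<close> and \<open>m\<close>. Together with the Codazzi
  equations, the second and third conclusions say that the mean curvature vector is parallel in the
  normal bundle; the fourth says that this bundle is flat.\<close>

lemma eigen_area:
  assumes p: "p \<in> V" and lap: "frame_laplacian r E area p = c *\<^sub>R area p"
  shows "minkowski (h11 p) (h11 p) + 2 * minkowski (h12 p) (h12 p) + minkowski (h22 p) (h22 p) = c"
    and "minkowski (e 1 p) n = 0 \<Longrightarrow> minkowski (e 2 p) n = 0 \<Longrightarrow>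
      minkowski (along (E 1) h12 p) n + minkowski (along (E 2) h22 p) n =
      \<omega> 1 p * (minkowski (h22 p) n - minkowski (h11 p) n) - 2 * \<omega> 2 p * minkowski (h12 p) n"
    and "minkowski (e 1 p) n = 0 \<Longrightarrow> minkowski (e 2 p) n = 0 \<Longrightarrow>
      minkowski (along (E 1) h11 p) n + minkowski (along (E 2) h12 p) n =
      \<omega> 2 p * (minkowski (h22 p) n - minkowski (h11 p) n) + 2 * \<omega> 1 p * minkowski (h12 p) n"
    and "minkowski (e 1 p) n = 0 \<Longrightarrow> minkowski (e 2 p) n = 0 \<Longrightarrow>
      minkowski (e 1 p) m = 0 \<Longrightarrow> minkowski (e 2 p) m = 0 \<Longrightarrow>
      minkowski (h11 p - h22 p) n * minkowski (h12 p) m = minkowski (h12 p) n * minkowski (h11 p - h22 p) m"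
proof -
  note form = bivector_form_add bivector_form_diff bivector_form_scaleR bivector_form_wedge
    frame_equations[OF p] minkowski_bilinear along_h_tangent[OF p] h_normal[OF p]
    h_normal'[OF p] orthonormal_e[OF p]
  have eq: "bivector_form (frame_laplacian r E area p) v w = bivector_form (c *\<^sub>R area p) v w" for v w
    using lap by simp
  note eq = eq[unfolded laplacian_area[OF p]]
  show "minkowski (h11 p) (h11 p) + 2 * minkowski (h12 p) (h12 p) + minkowski (h22 p) (h22 p) = c"
    using eq[of "e 1 p" "e 2 p"] by (simp add: form)
  {
    assume n: "minkowski (e 1 p) n = 0" "minkowski (e 2 p) n = 0"
    show "minkowski (along (E 1) h12 p) n + minkowski (along (E 2) h22 p) n =
        \<omega> 1 p * (minkowski (h22 p) n - minkowski (h11 p) n) - 2 * \<omega> 2 p * minkowski (h12 p) n"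
      using eq[of "e 1 p" n] by (simp add: form n algebra_simps)
    show "minkowski (along (E 1) h11 p) n + minkowski (along (E 2) h12 p) n =
        \<omega> 2 p * (minkowski (h22 p) n - minkowski (h11 p) n) + 2 * \<omega> 1 p * minkowski (h12 p) n"
      using eq[of "e 2 p" n] by (simp add: form n algebra_simps)
    assume m: "minkowski (e 1 p) m = 0" "minkowski (e 2 p) m = 0"
    show "minkowski (h11 p - h22 p) n * minkowski (h12 p) m = minkowski (h12 p) n * minkowski (h11 p - h22 p) m"
      using eq[of n m] by (simp add: form n m algebra_simps)
  }
qed

end

subsection \<open>The Gauss map as an eigenfunction\<close>

text \<open>In the application \<open>\<alpha>\<close> and \<open>h12\<close> are parallel, \<open>A\<close>, \<open>B\<close>, \<open>Q\<close> are the entries of their Gram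
  matrix, and \<open>P\<close>, \<open>m\<close>, \<open>n\<close>, \<open>- P\<close> are the products of their derivatives with them.\<close>

lemma rotation_rates:
  fixes A B Q P m n w :: real
  assumes "A + B \<noteq> 0" "A * B = Q\<^sup>2" "B * P = Q * m" "A * m = Q * P" "A * P = - (Q * n)" "B * n = - (Q * P)"
    and "m - n = 2 * (A + B) * w"
  shows "P = 2 * w * Q" "m + n = - 2 * w * (A - B)"
proof -
  \<comment> \<open>Here \<open>A * P\<close> and \<open>B * P\<close> add up to
    \<open>Q * (m - n)\<close>.\<close>
  have "(A + B) * P = (A + B) * (2 * w * Q)" using assms by algebra
  then show P: "P = 2 * w * Q" using assms(1) by simp
  \<comment> \<open>Since \<open>A * m\<close> and \<open>B * n\<close> cancel,
    \<open>(A + B) * (m + n) = - (A - B) * (m - n)\<close>.\<close>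
  have "(A + B) * (m + n) = (A + B) * (- 2 * w * (A - B))" using assms by algebra
  then show "m + n = - 2 * w * (A - B)" using assms(1) by (metis mult_left_cancel)
qed

context framed_surface begin

text \<open>Together with \<open>h12\<close> this is the trace-free part of the second fundamental
  form: \<open>h11\<close> and \<open>h22\<close> are the mean curvature vector plus and minus
  \<open>\<alpha>\<close>.\<close>

definition \<alpha> :: "real^2 \<Rightarrow> real^4" where "\<alpha> p = (1/2) *\<^sub>R (h11 p - h22 p)"

lemma smooth_\<alpha>: "smooth_on V \<alpha>"
  unfolding \<alpha>_def[abs_def] by (intro smooth_intros)

lemma along_\<alpha>:
  assumes "p \<in> V"
  shows "along X \<alpha> p = (1/2) *\<^sub>R (along X h11 p - along X h22 p)"
  unfolding \<alpha>_def[abs_def]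
  using bounded_bilinear.along[OF bounded_bilinear_scaleR open_V assms smooth_on_const
      smooth_on_diff[OF open_V smooth_h(1,3)], of X "1/2"] along_diff[OF open_V assms smooth_h(1,3)]
  by simp

theorem eigenvalue_zero:
  assumes light: "\<And>p. p \<in> V \<Longrightarrow> minkowski (mean_curvature_vector r E p) (mean_curvature_vector r E p) = 0"
    and lap: "\<And>p. p \<in> V \<Longrightarrow> frame_laplacian r E area p = c *\<^sub>R area p"
    and "p \<in> V"
  shows "c = 0"
proof (rule ccontr)
  assume "c \<noteq> 0"
  define A B Q where "A q = minkowski (\<alpha> q) (\<alpha> q)" and "B q = minkowski (h12 q) (h12 q)"
    and "Q q = minkowski (\<alpha> q) (h12 q)" for q
  have smooth: "smooth_on V A" "smooth_on V B" "smooth_on V Q"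
    unfolding A_def[abs_def] B_def[abs_def] Q_def[abs_def] by (intro smooth_intros smooth_\<alpha>)+
  have \<alpha>_normal: "minkowski (e 1 q) (\<alpha> q) = 0" "minkowski (e 2 q) (\<alpha> q) = 0"
    "minkowski (\<alpha> q) (e 1 q) = 0" "minkowski (\<alpha> q) (e 2 q) = 0" if "q \<in> V" for q
    using h_normal[OF that] h_normal'[OF that] by (simp_all add: \<alpha>_def minkowski_bilinear)
  have null: "minkowski (h11 q) (h11 q) + minkowski (h22 q) (h22 q) = - 2 * minkowski (h11 q) (h22 q)"
    if "q \<in> V" for q
    using light[OF that] unfolding mean_curvature_vector_eq[OF that]
    by (simp add: minkowski_bilinear minkowski_commute[of "h22 q" "h11 q"] field_simps)
  \<comment> \<open>This form of \<open>A\<close> makes the right side of the Gauss equation equal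
    to \<open>A q + B q\<close>.\<close>
  have A: "A q = - minkowski (h11 q) (h22 q)" if "q \<in> V" for q
    using null[OF that]
    by (simp add: A_def \<alpha>_def minkowski_bilinear minkowski_commute[of "h22 q" "h11 q"]
      field_simps)
  have AB: "A q + B q = c / 2" if "q \<in> V" for q
    using eigen_area(1)[OF that lap[OF that]] null[OF that] A[OF that] by (simp add: B_def)
  have parallel: "minkowski (\<alpha> q) v * minkowski (h12 q) w = minkowski (h12 q) v * minkowski (\<alpha> q) w"
    if q: "q \<in> V" for q v w
  proof -
    \<comment> \<open>\<open>N\<close> projects to the normal plane. As \<open>\<alpha> q\<close>
      and \<open>h12 q\<close> are normal, replacing \<open>v\<close> by \<open>N v\<close> does not
      change the products, so the identity extends from normal to all vectors.\<close>
    define N where "N v = v - minkowski v (e 1 q) *\<^sub>R e 1 q - minkowski v (e 2 q) *\<^sub>R e 2 q" for v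
    have "minkowski (e 1 q) (N v) = 0" "minkowski (e 2 q) (N v) = 0" for v
      by (simp_all add: N_def minkowski_bilinear orthonormal_e[OF q] minkowski_commute[of v])
    from eigen_area(4)[OF q lap[OF q] this this, of v w]
    have "minkowski (\<alpha> q) (N v) * minkowski (h12 q) (N w) = minkowski (h12 q) (N v) * minkowski (\<alpha> q) (N w)"
      by (simp add: \<alpha>_def minkowski_bilinear)
    then show ?thesis
      by (simp add: N_def minkowski_bilinear \<alpha>_normal[OF q] h_normal[OF q])
  qed
  have dA: "along X A q = 2 * minkowski (along X \<alpha> q) (\<alpha> q)"
    and dB: "along X B q = 2 * minkowski (along X h12 q) (h12 q)"
    and dQ: "along X Q q = minkowski (along X \<alpha> q) (h12 q) + minkowski (along X h12 q) (\<alpha> q)"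
    if q: "q \<in> V" for X q
    unfolding A_def[abs_def] B_def[abs_def] Q_def[abs_def]
    using minkowski.along[OF open_V q smooth_\<alpha> smooth_\<alpha>, of X]
      minkowski.along[OF open_V q smooth_h(2) smooth_h(2), of X]
      minkowski.along[OF open_V q smooth_\<alpha> smooth_h(2), of X]
    by (simp_all add: minkowski_commute)
  have rates: "minkowski (along (E i) \<alpha> q) (\<alpha> q) = 2 * \<omega> i q * Q q"
    "minkowski (along (E i) \<alpha> q) (h12 q) + minkowski (along (E i) h12 q) (\<alpha> q) = - 2 * \<omega> i q * (A q - B q)"
    if q: "q \<in> V" for q i
  proof -
    \<comment> \<open>The derivative of the constant \<open>A + B\<close>.\<close>
    have const: "minkowski (along (E i) h12 q) (h12 q) = - minkowski (along (E i) \<alpha> q) (\<alpha> q)" for i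
    proof -
      have "along (E i) (\<lambda>q. A q + B q) q = along (E i) (\<lambda>q. c / 2) q"
        by (rule along_cong[OF open_V q smooth_on_add[OF open_V smooth(1,2)]]) (rule AB)
      then show ?thesis
        unfolding along_add[OF open_V q smooth(1,2)] dA[OF q] dB[OF q] by simp
    qed
    \<comment> \<open>Combining the Codazzi equations with the eigenvalue equations leaves
      derivatives of \<open>\<alpha>\<close> and \<open>h12\<close> only.\<close>
    have c1: "minkowski (along (E 1) \<alpha> q) n + minkowski (along (E 2) h12 q) n =
        2 * \<omega> 1 q * minkowski (h12 q) n - 2 * \<omega> 2 q * minkowski (\<alpha> q) n"
      and c2: "minkowski (along (E 2) \<alpha> q) n - minkowski (along (E 1) h12 q) n =
        2 * \<omega> 2 q * minkowski (h12 q) n + 2 * \<omega> 1 q * minkowski (\<alpha> q) n"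
      if n: "minkowski (e 1 q) n = 0" "minkowski (e 2 q) n = 0" for n
      using codazzi_equations[OF q n] eigen_area(2,3)[OF q lap[OF q] n]
      by (simp_all add: along_\<alpha>[OF q] \<alpha>_def minkowski_bilinear field_simps)
    \<comment> \<open>For \<open>i = 1\<close>, add \<open>c1\<close> at \<open>h12 q\<close> and
      \<open>c2\<close> at \<open>\<alpha> q\<close>; for \<open>i = 2\<close>, subtract
      \<open>c1\<close> at \<open>\<alpha> q\<close> from \<open>c2\<close> at \<open>h12 q\<close>.
      The terms differentiated along the other frame field cancel by \<open>const\<close>.\<close>
    have diff: "minkowski (along (E i) \<alpha> q) (h12 q) - minkowski (along (E i) h12 q) (\<alpha> q) =
        2 * (A q + B q) * \<omega> i q"
      using exhaust_2[of i] c1[OF \<alpha>_normal(1,2)[OF q]] c1[OF h_normal'(3,4)[OF q]]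
        c2[OF \<alpha>_normal(1,2)[OF q]] c2[OF h_normal'(3,4)[OF q]]
        const[of 1] const[of 2]
      by (auto simp: A_def B_def algebra_simps minkowski_commute[of "h12 q" "\<alpha> q"])
    have nz: "A q + B q \<noteq> 0" using AB[OF q] \<open>c \<noteq> 0\<close> by simp
    have prod: "A q * B q = (Q q)\<^sup>2"
      using parallel[OF q, of "\<alpha> q" "h12 q"]
      by (simp add: A_def B_def Q_def power2_eq_square minkowski_commute[of "h12 q" "\<alpha> q"])
    have par: "B q * minkowski (along (E i) \<alpha> q) (\<alpha> q) = Q q * minkowski (along (E i) \<alpha> q) (h12 q)"
      "A q * minkowski (along (E i) \<alpha> q) (h12 q) = Q q * minkowski (along (E i) \<alpha> q) (\<alpha> q)"
      "A q * minkowski (along (E i) \<alpha> q) (\<alpha> q) = - (Q q * minkowski (along (E i) h12 q) (\<alpha> q))"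
      "B q * minkowski (along (E i) h12 q) (\<alpha> q) = - (Q q * minkowski (along (E i) \<alpha> q) (\<alpha> q))"
      using parallel[OF q, of "h12 q" "along (E i) \<alpha> q"] parallel[OF q, of "\<alpha> q" "along (E i) \<alpha> q"]
        parallel[OF q, of "\<alpha> q" "along (E i) h12 q"]
        parallel[OF q, of "h12 q" "along (E i) h12 q"] const[of i]
      by (simp_all add: A_def B_def Q_def minkowski_commute mult.commute)
    show "minkowski (along (E i) \<alpha> q) (\<alpha> q) = 2 * \<omega> i q * Q q"
      "minkowski (along (E i) \<alpha> q) (h12 q) + minkowski (along (E i) h12 q) (\<alpha> q) = - 2 * \<omega> i q * (A q - B q)"
      using rotation_rates[OF nz prod par diff] by simp_all
  qed
  define C where "C q = A q - B q" for q
  have smooth_C: "smooth_on V C"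
    unfolding C_def[abs_def] by (intro smooth_intros smooth)
  \<comment> \<open>\<open>C\<close> and \<open>Q\<close> satisfy a closed first-order system with
    coefficients in \<open>\<omega>\<close>: the pair of \<open>C\<close> and \<open>2 * Q\<close>
    rotates. The commutator relation will be applied to it.\<close>
  have dC: "along (E i) C q = 8 * \<omega> i q * Q q" and dQ: "along (E i) Q q = - 2 * \<omega> i q * C q"
    if q: "q \<in> V" for i q
  proof -
    have "along (E i) C q = along (E i) A q - along (E i) B q"
      unfolding C_def[abs_def] by (rule along_diff[OF open_V q smooth(1,2)])
    also have "along (E i) B q = - along (E i) A q"
      using along_add[OF open_V q smooth(1,2), of "E i"]
        along_cong[OF open_V q smooth_on_add[OF open_V smooth(1,2)] AB, of "E i"] by simp
    finally show "along (E i) C q = 8 * \<omega> i q * Q q"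
      using rates(1)[OF q, of i] dA[OF q, of "E i"] by simp
    show "along (E i) Q q = - 2 * \<omega> i q * C q"
      using rates(2)[OF q, of i] dQ[OF q, of "E i"] by (simp add: C_def)
  qed
  have second: "along (E i) (along (E j) f) p = k * (\<omega> j p * along (E i) g p + along (E i) (\<omega> j) p * g p)"
    if "smooth_on V f" "smooth_on V g" "\<And>q. q \<in> V \<Longrightarrow> along (E j) f q = k * \<omega> j q * g q"
    for i j k and f g :: "real^2 \<Rightarrow> real"
  proof -
    have "along (E i) (along (E j) f) p = along (E i) (\<lambda>q. k * (\<omega> j q * g q)) p"
      by (rule along_cong[OF open_V \<open>p \<in> V\<close> smooth_on_along[OF open_V smooth_E that(1)]])
        (simp add: that(3) mult.assoc)
    also have "\<dots> = k * along (E i) (\<lambda>q. \<omega> j q * g q) p"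
      by (rule along_linear[OF open_V \<open>p \<in> V\<close> smooth_on_mult[OF open_V smooth_\<omega> that(2)]
        bounded_linear_mult_right])
    also have "along (E i) (\<lambda>q. \<omega> j q * g q) p = \<omega> j p * along (E i) g p + along (E i) (\<omega> j) p * g p"
      by (rule bounded_bilinear.along[OF bounded_bilinear_mult open_V \<open>p \<in> V\<close> smooth_\<omega> that(2)])
    finally show ?thesis .
  qed
  \<comment> \<open>The value of d\<omega> on the frame; the squares come from the bracket of
    \<open>E 1\<close> and \<open>E 2\<close>, whose coefficients are \<open>- \<omega> 1 p\<close>
    and \<open>- \<omega> 2 p\<close>.\<close>
  define K where "K = along (E 1) (\<omega> 2) p - along (E 2) (\<omega> 1) p + (\<omega> 1 p)\<^sup>2 + (\<omega> 2 p)\<^sup>2"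
  have "K = c / 2"
    unfolding K_def gauss_equation[OF \<open>p \<in> V\<close>] using A[OF \<open>p \<in> V\<close>] AB[OF \<open>p \<in> V\<close>] by (simp add: B_def)
  have second_C: "along (E i) (along (E j) C) p =
      8 * (\<omega> j p * along (E i) Q p + along (E i) (\<omega> j) p * Q p)" for i j
    by (rule second[OF smooth_C smooth(3) dC])
  have second_Q: "along (E i) (along (E j) Q) p =
      - 2 * (\<omega> j p * along (E i) C p + along (E i) (\<omega> j) p * C p)" for i j
    by (rule second[OF smooth(3) smooth_C dQ])
  \<comment> \<open>The terms with the product of \<open>\<omega> 1 p\<close> and
    \<open>\<omega> 2 p\<close> cancel in the commutator, and the remaining factor is exactly
    \<open>K\<close>.\<close>
  have "8 * (K * Q p) = 0"
    using frame_commute[OF \<open>p \<in> V\<close> smooth_C]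
    unfolding second_C dC[OF \<open>p \<in> V\<close>] dQ[OF \<open>p \<in> V\<close>]
    by (simp add: K_def power2_eq_square algebra_simps)
  moreover have "2 * (K * C p) = 0"
    using frame_commute[OF \<open>p \<in> V\<close> smooth(3)]
    unfolding second_Q dC[OF \<open>p \<in> V\<close>] dQ[OF \<open>p \<in> V\<close>]
    by (simp add: K_def power2_eq_square algebra_simps)
  \<comment> \<open>These values give \<open>A p = B p\<close> and \<open>A p * B p = 0\<close>, so
    both vanish although their sum is \<open>c / 2\<close>.\<close>
  ultimately have "Q p = 0" "C p = 0" using \<open>K = c / 2\<close> \<open>c \<noteq> 0\<close> by auto
  moreover have "A p * B p = (Q p)\<^sup>2"
    using parallel[OF \<open>p \<in> V\<close>, of "\<alpha> p" "h12 p"]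
    by (simp add: A_def B_def Q_def power2_eq_square minkowski_commute[of "h12 p" "\<alpha> p"])
  ultimately have "A p + B p = 0" by (simp add: C_def)
  then show False using AB[OF \<open>p \<in> V\<close>] \<open>c \<noteq> 0\<close> by simp
qed

end

section \<open>From the area bivector back to the Gauss map\<close>

lemma (in framed_surface) frame_laplacian_linear:
  fixes f :: "real^2 \<Rightarrow> 'b::real_normed_vector" and L :: "'b \<Rightarrow> 'c::real_normed_vector"
  assumes p: "p \<in> V" and f: "smooth_on V f" and L: "bounded_linear L"
    and g: "\<And>q. q \<in> V \<Longrightarrow> g q = L (f q)"
  shows "frame_laplacian r E g p = L (frame_laplacian r E f p)"
proof -
  note Lf = smooth_on_linear[OF open_V f L]
  have smooth_g: "smooth_on V g" by (rule smooth_on_cong[OF open_V _ Lf]) (simp add: g)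
  have d: "along (E i) g q = L (along (E i) f q)" if "q \<in> V" for i q
    using along_cong[OF open_V that smooth_g g] along_linear[OF open_V that f L] by metis
  have dd: "along (E i) (along (E i) g) p = L (along (E i) (along (E i) f) p)" for i
    using along_cong[OF open_V p smooth_on_along[OF open_V smooth_E smooth_g] d]
      along_linear[OF open_V p smooth_on_along[OF open_V smooth_E f] L] by metis
  interpret L: bounded_linear L by (rule L)
  show ?thesis
    unfolding frame_laplacian_eq[OF p smooth_g] frame_laplacian_eq[OF p f] d[OF p] dd
    by (simp add: L.diff L.scaleR)
qed

text \<open>The constant linear map \<open>hodge\<close> commutes with the Laplacian, so near
  \<open>p\<close> the eigenvalue equation passes from the Gauss map to the area bivector, and
  \<open>eigenvalue_zero\<close> applies.\<close>

lemma gauss_map_eigenvalue_zero: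
  assumes M: "oriented_surface M A" and im: "smooth_immersion A x" and sp: "space_like_surface A x"
    and light: "light_like_mean_curvature A x"
    and lap: "has_laplacian A x (gauss_map A x) (\<lambda>q. c *\<^sub>R gauss_map A x q)"
    and frame: "tangent_frame A x \<phi> V E" and p: "p \<in> V"
  shows "c = 0"
proof -
  define r where "r = x \<circ> \<phi>"
  obtain U where U: "(U, \<phi>) \<in> A" "V \<subseteq> U" and open_V: "open V" and smooth_E: "\<And>i. smooth_on V (E i)"
    and orth: "\<And>q i j. q \<in> V \<Longrightarrow>
      minkowski (along (E i) r q) (along (E j) r q) = (if i = j then 1 else 0)"
    using frame unfolding tangent_frame_def r_def by blast
  have smooth_r: "smooth_on V r"
    using im U smooth_on_subset unfolding smooth_immersion_def r_def by blast
  define \<delta> where "\<delta> q = det (vector [E 1 q, E 2 q] :: real^2^2)" for q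
  define s where "s = sgn (\<delta> p)"
  \<comment> \<open>The frame may have either orientation, even different ones on different
    components of \<open>V\<close>. On \<open>V'\<close> the sign is constantly \<open>s\<close> and
    can be pulled out of derivatives.\<close>
  define V' where "V' = V \<inter> (\<lambda>q. s * \<delta> q) -` {0<..}"
  have V'V: "q \<in> V" if "q \<in> V'" for q using that by (simp add: V'_def)
  have "continuous_on V (\<lambda>q. s * \<delta> q)"
    unfolding \<delta>_def det_vector_2 using smooth_on_continuous_on[OF smooth_E]
    by (intro continuous_intros)
  then have open_V': "open V'"
    unfolding V'_def using open_V by (intro continuous_open_preimage) simp_all
  have ortho: "minkowski (frechet_derivative r (at q) (E 1 q)) (frechet_derivative r (at q) (E 1 q)) = 1"
    "minkowski (frechet_derivative r (at q) (E 2 q)) (frechet_derivative r (at q) (E 2 q)) = 1"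
    "minkowski (frechet_derivative r (at q) (E 1 q)) (frechet_derivative r (at q) (E 2 q)) = 0"
    if "q \<in> V" for q
    using orth[OF that, of 1 1] orth[OF that, of 2 2] orth[OF that, of 1 2]
    by (simp_all add: along_def)
  have "\<delta> p \<noteq> 0"
    unfolding \<delta>_def
    using orthonormal_det_nonzero[OF has_derivative_linear[OF smooth_on_has_derivative[OF smooth_r open_V p]]]
      ortho[OF p] by blast
  then have ss: "s * s = 1" and "p \<in> V'"
    using p by (auto simp: s_def V'_def sgn_real_def)
  interpret framed_surface r V' E
  proof
    show "open V'" by (rule open_V')
    have "V' \<subseteq> V" using V'V by blast
    then show "smooth_on V' r" "smooth_on V' (E i)" for i
      using smooth_r smooth_E smooth_on_subset by blast+
    show "minkowski (along (E i) r q) (along (E j) r q) = (if i = j then 1 else 0)" if "q \<in> V'" for q i j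
      by (rule orth[OF V'V[OF that]])
  qed
  have gauss_map: "gauss_map A x (\<phi> q) = hodge (s *\<^sub>R area q)" if "q \<in> V'" for q
  proof -
    have "sgn (\<delta> q) = s"
      using that \<open>\<delta> p \<noteq> 0\<close> by (auto simp: V'_def s_def sgn_real_def zero_less_mult_iff split: if_splits)
    then show ?thesis
      using gauss_map_eq_hodge[OF M im sp U(1) _ refl, of q "E 1 q" "E 2 q"]
        ortho[OF V'V[OF that]] V'V[OF that] U(2)
      by (auto simp: r_def \<delta>_def along_def)
  qed
  have hodge: "bounded_linear hodge" using linear_hodge by (simp add: linear_conv_bounded_linear)
  have smooth_area: "smooth_on V' area" by (intro smooth_intros)
  have smooth: "smooth_on V' (gauss_map A x \<circ> \<phi>)"
    by (rule smooth_on_cong[OF open_V' _ smooth_on_linear[OF open_V'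
        smooth_on_scaleR[OF open_V' smooth_on_const smooth_area] hodge]])
      (simp add: gauss_map)
  have L: "bounded_linear (\<lambda>W. (- s) *\<^sub>R hodge W)"
    by (rule bounded_linear_const_scaleR[OF hodge])
  \<comment> \<open>The formula for the Gauss map is inverted: \<open>hodge\<close> applied twice
    gives the sign -1 on wedges, and \<open>s * s = 1\<close>.\<close>
  have area: "area q = (- s) *\<^sub>R hodge ((gauss_map A x \<circ> \<phi>) q)" if "q \<in> V'" for q
    using ss by (simp add: gauss_map[OF that] linear_scale[OF linear_hodge] hodge_hodge_wedge)
  have "frame_laplacian r E area q = c *\<^sub>R area q" if "q \<in> V'" for q
  proof -
    have "frame_laplacian r E (gauss_map A x \<circ> \<phi>) q = c *\<^sub>R (gauss_map A x \<circ> \<phi>) q"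
      using lap frame V'V[OF that] unfolding has_laplacian_def r_def by simp
    moreover have "frame_laplacian r E area q =
        (- s) *\<^sub>R hodge (frame_laplacian r E (gauss_map A x \<circ> \<phi>) q)"
      by (rule frame_laplacian_linear[OF that smooth L area])
    ultimately show ?thesis
      unfolding area[OF that]
      by (simp add: linear_scale[OF linear_hodge])
  qed
  moreover have "minkowski (mean_curvature_vector r E q) (mean_curvature_vector r E q) = 0" if "q \<in> V'" for q
    using light frame V'V[OF that] unfolding light_like_mean_curvature_def light_like_def r_def by blast
  ultimately show "c = 0" using eigenvalue_zero \<open>p \<in> V'\<close> by blast
qed

theorem proposition4p7:
  fixes M :: "'m topology"
    and A :: "((real^2) set \<times> (real^2 \<Rightarrow> 'm)) set"
    and x :: "'m \<Rightarrow> real^4"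
  assumes "oriented_surface M A"
    and "smooth_immersion A x"
    and "space_like_surface A x"
    and "light_like_mean_curvature A x"
  shows "one_type_gauss_map_first_kind A x \<longleftrightarrow> harmonic_gauss_map A x"
proof
  assume "one_type_gauss_map_first_kind A x"
  then obtain c where c: "has_laplacian A x (gauss_map A x) (\<lambda>q. c *\<^sub>R gauss_map A x q)"
    unfolding one_type_gauss_map_first_kind_def by blast
  show "harmonic_gauss_map A x"
    unfolding harmonic_gauss_map_def has_laplacian_def
  \<comment> \<open>That \<open>c = 0\<close> is known only once a framed point is given, which the
    quantifiers provide here. On an empty surface \<open>c\<close> stays arbitrary and the claim is
    vacuous.\<close>
  proof (intro allI impI ballI)
    fix \<phi> V E p assume "tangent_frame A x \<phi> V E" "p \<in> V"
    then show "frame_laplacian (x \<circ> \<phi>) E (gauss_map A x \<circ> \<phi>) p = 0"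
      using gauss_map_eigenvalue_zero[OF assms c] c unfolding has_laplacian_def by fastforce
  qed
next
  assume "harmonic_gauss_map A x"
  then have "has_laplacian A x (gauss_map A x) (\<lambda>q. 0 *\<^sub>R gauss_map A x q)"
    by (simp add: harmonic_gauss_map_def)
  then show "one_type_gauss_map_first_kind A x"
    unfolding one_type_gauss_map_first_kind_def by blast
qed

end
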